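(* Let $n\ge 1$, let $\theta:\mathbb{R}^n\to[0,\infty)$ be a decreasing radial function with $\lim_{|y|\to\infty}\theta(y)=0$, and let $$I=\int_{|y|\ge 1}\frac{\theta(y)}{|y|^n}\,dy .$$ (a) Let $f\in L^1(\mathbb{R}^n)$ be a function for which there is a constant $C$ such that $$|\widehat f(y)|\le C e^{-\theta(y)|y|}\quad\text{for all } y\in\mathbb{R}^n. \qquad ( * )$$ If $f$ vanishes on a nonempty open set and $I=\infty$, then $f(x)=0$ for almost every $x\in\mathbb{R}^n$. (b) If $I$ is finite, then there exists a nontrivial $f\in C_c^\infty(\mathbb{R}^n)$ satisfying $( * )$ for some constant $C$.
   Context: The Fourier transform is $\widehat f(y)=\int_{\mathbb{R}^n}f(x)e^{-2\pi i x\cdot y}\,dx$. A radial function $\theta$ is called decreasing if $\theta(y)$ is a decreasing function of $|y|$. $C_c^\infty(\mathbb{R}^n)$ is the space of compactly supported smooth functions. *)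

theory Defs
  imports "HOL-Analysis.Analysis"
begin

definition fourier_transform :: "(real ^ 'n \<Rightarrow> complex) \<Rightarrow> real ^ 'n \<Rightarrow> complex" where
  "fourier_transform f y =
     (LINT x|lebesgue. f x * exp (- 2 * complex_of_real pi * \<i> * complex_of_real (x \<bullet> y)))"

(* "Decreasing" is meant in the weak sense. *)
definition decreasing_radial :: "(real ^ 'n \<Rightarrow> real) \<Rightarrow> bool" where
  "decreasing_radial \<theta> \<longleftrightarrow>
     (\<exists>\<phi>::real \<Rightarrow> real. antimono_on {0..} \<phi> \<and> (\<forall>y. \<theta> y = \<phi> (norm y)))"

(* Taken in [0,\<infinity>], so that divergence is the value \<infinity>
   (the real-valued integral would be 0 in that case). *)
definition tail_integral :: "(real ^ 'n \<Rightarrow> real) \<Rightarrow> ennreal" where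
  "tail_integral \<theta> =
     (\<integral>\<^sup>+y\<in>{y. 1 \<le> norm y}. ennreal (\<theta> y / norm y ^ CARD('n)) \<partial>lebesgue)"

(* k times continuously differentiable on the whole space, via iterated directional
   derivatives; for k > 0 the continuity of the lower-order derivatives comes from
   their (Frechet) differentiability. *)
fun Ck :: "nat \<Rightarrow> ('a::real_normed_vector \<Rightarrow> 'b::real_normed_vector) \<Rightarrow> bool" where
  "Ck 0 f \<longleftrightarrow> continuous_on UNIV f"
| "Ck (Suc k) f \<longleftrightarrow>
     (\<forall>x. f differentiable (at x)) \<and> (\<forall>v. Ck k (\<lambda>x. frechet_derivative f (at x) v))"

definition Cc_infinity :: "(real ^ 'n \<Rightarrow> complex) set" where
  "Cc_infinity = {f. (\<forall>k. Ck k f) \<and> compact (closure {x. f x \<noteq> 0})}"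

definition fourier_decay :: "(real ^ 'n \<Rightarrow> real) \<Rightarrow> (real ^ 'n \<Rightarrow> complex) \<Rightarrow> bool" where
  "fourier_decay \<theta> f \<longleftrightarrow>
     (\<exists>C::real. \<forall>y. norm (fourier_transform f y) \<le> C * exp (- \<theta> y * norm y))"

end

theory Submission
  imports Defs "HOL-Probability.Probability"
begin

text \<open>
  This is Ingham's theorem on the decay of Fourier transforms of functions that vanish on an open
  set. Let \<open>\<phi>\<close> be the radial profile of \<open>\<theta>\<close>. Cutting
  \<open>|y| \<ge> 1\<close> into dyadic shells shows that \<open>I\<close> is finite exactly if
  \<open>\<Sum> \<phi> (2 ^ k)\<close> converges (\<open>tail_integral_finite_iff\<close>), so that
  both parts are statements about this series.

  Suppose that the series converges. By Cauchy condensation so does \<open>\<Sum> a j\<close> with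
  \<open>a j = \<phi> j / j\<close>. The convolution of a bump with the normalized indicator
  functions of all intervals \<open>[- a j, a j]\<close> then has compact support, and it is smooth
  because every single convolution contributes one derivative. Its Fourier transform at
  \<open>s\<close> contains the product of the factors \<open>sin x / x\<close> at \<open>x = 2 pi a
  j s\<close>. For the roughly \<open>s \<phi> s\<close> indices \<open>j \<le> s \<phi> s\<close>,
  where \<open>s\<close> is so large that \<open>\<phi> s \<le> 1\<close>, one has \<open>a j s
  \<ge> 1\<close>, because \<open>\<phi>\<close> decreases, and each of these factors is at most
  \<open>1 / e\<close>, which gives the decay \<open>exp (- s \<phi> s)\<close>
  (\<open>fast_decaying_kernel\<close>). A product over the coordinates carries this to higher
  dimensions (\<open>ingham_construction\<close>).

  Suppose that the series diverges and that \<open>f\<close> vanishes on a ball. Convolve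
  \<open>f\<close> with a product kernel \<open>g\<close> of the kind just described, with small
  support and with a transform that decays like \<open>exp (- 5 sqrt |y|)\<close>. Then \<open>f *
  g\<close> vanishes near the centre of the ball, and it is the inverse Fourier transform of an
  integrable function \<open>W\<close>. Along a line through the centre its \<open>m\<close>-th
  derivative is bounded by a moment \<open>M m\<close> of \<open>|W|\<close>. Moments are
  log-convex, and \<open>M m \<le> A (K m / \<phi> (m ^ 4)) ^ m\<close>
  (\<open>moment_weight_bound\<close>); here the square root decay takes care of the frequencies
  beyond \<open>m ^ 4\<close>, for which nothing else is known if \<open>\<phi>\<close> drops
  abruptly. A dyadic form of Carleman's inequality (\<open>carleman_dyadic\<close>) turns the
  divergence of \<open>\<Sum> \<phi> (2 ^ k)\<close> into the divergence of \<open>\<Sum> M m / M (m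
  + 1)\<close>. This is the Denjoy-Carleman condition, and Bang's elementary argument
  (\<open>bang_quasianalytic\<close>) shows that a function all of whose derivatives vanish at one
  point vanishes on the line. Hence \<open>f * g = 0\<close> (\<open>convolution_vanishes\<close>).
  Letting the support of \<open>g\<close> shrink, the integral of \<open>f\<close> over every box is
  zero, and so \<open>f = 0\<close> almost everywhere.
\<close>


section \<open>Averages over an interval\<close>

text \<open>
  The uniform distribution on \<open>[-1, 1]\<close>. Averaging against a fixed probability measure,
  with the width as a factor inside the argument, keeps the width zero regular and lets all
  estimates be estimates of expectations.
\<close>

definition unif :: "real measure" where
  "unif = density lborel (\<lambda>u. ennreal (indicator {-1..1} u / 2))"

lemma sets_unif [measurable_cong, simp]: "sets unif = sets borel"
  by (simp add: unif_def)

lemma space_unif [simp]: "space unif = UNIV"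
  by (simp add: unif_def)

lemma prob_space_unif: "prob_space unif"
proof
  have "emeasure unif UNIV = (\<integral>\<^sup>+u. ennreal (indicator {-1..1::real} u / 2) \<partial>lborel)"
    unfolding unif_def by (subst emeasure_density) auto
  also have "\<dots> = (\<integral>\<^sup>+u. ennreal (1/2) * indicator {-1..1::real} u \<partial>lborel)"
    by (intro nn_integral_cong) (auto split: split_indicator)
  also have "\<dots> = ennreal (1/2) * ennreal 2"
    by (subst nn_integral_cmult_indicator) auto
  also have "\<dots> = 1"
    by (subst ennreal_mult[symmetric]) auto
  finally show "emeasure unif (space unif) = 1" by simp
qed

interpretation unif: prob_space unif
  by (rule prob_space_unif)

lemma AE_unif: "AE u in unif. \<bar>u\<bar> \<le> 1"
  unfolding unif_def by (subst AE_density) (auto split: split_indicator)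

lemma integral_unif:
  fixes f :: "real \<Rightarrow> 'a::{banach, second_countable_topology}"
  assumes "f \<in> borel_measurable borel"
  shows "integral\<^sup>L unif f = (1/2) *\<^sub>R (LINT u|lborel. indicator {-1..1} u *\<^sub>R f u)"
proof -
  have "integral\<^sup>L unif f = (LINT u|lborel. (indicator {-1..1} u / 2) *\<^sub>R f u)"
    unfolding unif_def by (rule integral_density) (use assms in auto)
  also have "\<dots> = (LINT u|lborel. (1/2) *\<^sub>R (indicator {-1..1} u *\<^sub>R f u))"
    by (intro Bochner_Integration.integral_cong) auto
  also have "\<dots> = (1/2) *\<^sub>R (LINT u|lborel. indicator {-1..1} u *\<^sub>R f u)"
    by (rule integral_scaleR_right)
  finally show ?thesis .
qed

definition box_avg :: "real \<Rightarrow> (real \<Rightarrow> real) \<Rightarrow> real \<Rightarrow> real" where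
  "box_avg a g t = (LINT u|unif. g (t + a * u))"

lemma lipschitz_borel [measurable_dest]:
  fixes g :: "real \<Rightarrow> real"
  assumes "L-lipschitz_on UNIV g"
  shows "g \<in> borel_measurable borel"
  using assms by (intro borel_measurable_continuous_onI lipschitz_on_continuous_on)

lemma lipschitz_abs:
  fixes g :: "real \<Rightarrow> real"
  assumes "L-lipschitz_on UNIV g"
  shows "\<bar>g x - g y\<bar> \<le> L * \<bar>x - y\<bar>"
  using lipschitz_onD[OF assms, of x y] by (simp add: dist_real_def)

lemma integrable_box_avg:
  fixes g :: "real \<Rightarrow> real"
  assumes g: "L-lipschitz_on UNIV g"
  shows "integrable unif (\<lambda>u. g (t + a * u))"
proof (rule unif.integrable_const_bound[where B = "\<bar>g t\<bar> + L * \<bar>a\<bar>"])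
  note [measurable] = lipschitz_borel[OF g]
  show "(\<lambda>u. g (t + a * u)) \<in> borel_measurable unif" by measurable
  show "AE u in unif. norm (g (t + a * u)) \<le> \<bar>g t\<bar> + L * \<bar>a\<bar>"
    using AE_unif
  proof eventually_elim
    case (elim u)
    have L: "L \<ge> 0" using g by (rule lipschitz_on_nonneg)
    have "\<bar>g (t + a * u) - g t\<bar> \<le> L * (\<bar>a\<bar> * \<bar>u\<bar>)"
      using lipschitz_abs[OF g, of "t + a * u" t] by (simp add: abs_mult)
    also have "\<dots> \<le> L * (\<bar>a\<bar> * 1)"
      using L elim by (intro mult_left_mono) auto
    finally show ?case by simp
  qed
qed

lemma box_avg_diff_le:
  assumes "L-lipschitz_on UNIV g" "K-lipschitz_on UNIV h" "\<And>t. \<bar>g t - h t\<bar> \<le> e"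
  shows "\<bar>box_avg a g t - box_avg a h t\<bar> \<le> e"
proof -
  note i = integrable_box_avg[OF assms(1), of t a] integrable_box_avg[OF assms(2), of t a]
  have "\<bar>box_avg a g t - box_avg a h t\<bar> = \<bar>LINT u|unif. g (t + a * u) - h (t + a * u)\<bar>"
    unfolding box_avg_def using i by simp
  also have "\<dots> \<le> (LINT u|unif. \<bar>g (t + a * u) - h (t + a * u)\<bar>)"
    by (rule integral_abs_bound)
  also have "\<dots> \<le> (LINT u|unif. e)"
    using i assms(3) by (intro integral_mono) auto
  finally show ?thesis by (simp add: unif.prob_space[simplified])
qed

lemma box_avg_lipschitz:
  assumes g: "L-lipschitz_on UNIV g"
  shows "L-lipschitz_on UNIV (box_avg a g)"
proof (rule lipschitz_onI)
  show "L \<ge> 0" using g by (rule lipschitz_on_nonneg)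
  fix s t :: real
  note i = integrable_box_avg[OF g, of s a] integrable_box_avg[OF g, of t a]
  have "\<bar>box_avg a g s - box_avg a g t\<bar> = \<bar>LINT u|unif. g (s + a * u) - g (t + a * u)\<bar>"
    unfolding box_avg_def using i by simp
  also have "\<dots> \<le> (LINT u|unif. \<bar>g (s + a * u) - g (t + a * u)\<bar>)"
    by (rule integral_abs_bound)
  also have "\<dots> \<le> (LINT u|unif. L * \<bar>s - t\<bar>)"
  proof (intro integral_mono)
    show "\<bar>g (s + a * u) - g (t + a * u)\<bar> \<le> L * \<bar>s - t\<bar>" for u
      using lipschitz_abs[OF g, of "s + a * u" "t + a * u"] by simp
  qed (use i in auto)
  finally show "dist (box_avg a g s) (box_avg a g t) \<le> L * dist s t"
    by (simp add: unif.prob_space[simplified] dist_real_def)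
qed

text \<open>
  This bound makes successive averages with summable widths converge uniformly; it is the reason for
  carrying a Lipschitz constant along, which averaging does not increase.
\<close>

lemma box_avg_near:
  assumes g: "L-lipschitz_on UNIV g" and a: "a \<ge> 0"
  shows "\<bar>box_avg a g t - g t\<bar> \<le> L * a"
proof -
  note i = integrable_box_avg[OF g, of t a]
  have L: "L \<ge> 0" using g by (rule lipschitz_on_nonneg)
  have "\<bar>box_avg a g t - g t\<bar> = \<bar>LINT u|unif. g (t + a * u) - g t\<bar>"
    unfolding box_avg_def using i by (simp add: unif.prob_space[simplified])
  also have "\<dots> \<le> (LINT u|unif. \<bar>g (t + a * u) - g t\<bar>)"
    by (rule integral_abs_bound)
  also have "\<dots> \<le> (LINT u|unif. L * a)"
  proof (intro integral_mono_AE)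
    show "AE u in unif. \<bar>g (t + a * u) - g t\<bar> \<le> L * a"
      using AE_unif
    proof eventually_elim
      case (elim u)
      have "\<bar>g (t + a * u) - g t\<bar> \<le> L * (a * \<bar>u\<bar>)"
        using lipschitz_abs[OF g, of "t + a * u" t] a by (simp add: abs_mult)
      also have "\<dots> \<le> L * (a * 1)"
        using L elim a by (intro mult_left_mono) auto
      finally show ?case by simp
    qed
  qed (use i in auto)
  finally show ?thesis by (simp add: unif.prob_space[simplified])
qed

lemma box_avg_nonneg: "(\<And>t. g t \<ge> 0) \<Longrightarrow> box_avg a g t \<ge> 0"
  unfolding box_avg_def by (intro integral_nonneg_AE) auto

lemma box_avg_support:
  assumes "\<And>t. \<bar>t\<bar> > r \<Longrightarrow> g t = 0" "\<bar>t\<bar> > r + a" "a \<ge> 0"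
  shows "box_avg a g t = 0"
proof -
  have "AE u in unif. g (t + a * u) = 0"
    using AE_unif
  proof eventually_elim
    case (elim u)
    have "\<bar>a * u\<bar> \<le> a" using elim assms(3) by (simp add: abs_mult mult_left_le)
    then show ?case using assms(2) by (intro assms(1)) linarith
  qed
  then show ?thesis unfolding box_avg_def by (rule integral_eq_zero_AE)
qed

text \<open>
  Averaging gains one derivative, and the derivative is again expressed by translates of the
  averaged function. This is the source of the smoothness of infinite averages.
\<close>

lemma box_avg_has_derivative:
  assumes g: "continuous_on UNIV g" and a: "a > 0"
  shows "(box_avg a g has_real_derivative (g (t + a) - g (t - a)) / (2 * a)) (at t)"
proof -
  define G where "G x = (LBINT y=ereal 0..ereal x. g y)" for x :: real
  have G: "(G has_real_derivative g x) (at x)" for x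
  proof -
    \<comment> \<open>The fundamental theorem is applied on a bounded interval that contains \<open>x\<close> in its interior.\<close>
    let ?R = "\<bar>x\<bar> + 1"
    have "((\<lambda>u. LBINT y=ereal 0..ereal u. g y) has_vector_derivative g x) (at x within {- ?R..?R})"
      by (rule interval_integral_FTC2) (use g in \<open>auto intro: continuous_on_subset\<close>)
    moreover have "at x within {- ?R..?R} = at x"
      by (rule at_within_interior) auto
    ultimately show ?thesis
      by (simp add: G_def[abs_def] has_real_derivative_iff_has_vector_derivative)
  qed
  have eq: "box_avg a g t = (G (t + a) - G (t - a)) / (2 * a)" for t
  proof -
    have "(LINT u|lborel. indicator {-1..1} u *\<^sub>R g (t + a * u)) = G (t + a * 1) / a - G (t + a * (-1)) / a"
    proof (rule integral_FTC_Icc)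
      show "((\<lambda>u. G (t + a * u) / a) has_vector_derivative g (t + a * x)) (at x within {-1..1})" for x
        unfolding has_real_derivative_iff_has_vector_derivative[symmetric]
        by (rule derivative_eq_intros DERIV_chain2[OF G] has_field_derivative_at_within | (use a in simp))+
      show "continuous_on {-1..1} (\<lambda>u. g (t + a * u))"
        by (intro continuous_on_compose2[OF g]) (auto intro!: continuous_intros)
    qed simp
    moreover have "(\<lambda>u. g (t + a * u)) \<in> borel_measurable borel"
      by (intro borel_measurable_continuous_onI continuous_on_compose2[OF g]) (auto intro!: continuous_intros)
    ultimately show ?thesis
      using a by (simp add: box_avg_def integral_unif field_simps)
  qed
  have "((\<lambda>t. G (t + a)) has_real_derivative g (t + a) * 1) (at t)"
    by (rule DERIV_chain2[OF G]) (auto intro!: derivative_eq_intros)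
  moreover have "((\<lambda>t. G (t - a)) has_real_derivative g (t - a) * 1) (at t)"
    by (rule DERIV_chain2[OF G]) (auto intro!: derivative_eq_intros)
  ultimately show ?thesis
    unfolding eq[abs_def] using DERIV_cdivide[OF DERIV_diff] by force
qed

section \<open>Closure properties of the classes Ck\<close>

lemma Ck_SucI:
  assumes "\<And>x. (f has_derivative f' x) (at x)" "\<And>v. Ck k (\<lambda>x. f' x v)"
  shows "Ck (Suc k) f"
  using assms by (auto simp: differentiable_def frechet_derivative_at[OF assms(1), symmetric])

lemma Ck_SucD:
  assumes "Ck (Suc k) f"
  shows "(f has_derivative frechet_derivative f (at x)) (at x)" "Ck k (\<lambda>x. frechet_derivative f (at x) v)"
  using assms by (auto simp: frechet_derivative_works)

lemma Ck_Suc_imp: "Ck (Suc k) f \<Longrightarrow> Ck k f"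
proof (induction k arbitrary: f)
  case 0
  then have "f differentiable at x" for x by simp
  then show ?case
    by (simp add: continuous_at_imp_continuous_on differentiable_imp_continuous_within)
qed auto

lemma Ck_const: "Ck k (\<lambda>x. c)"
proof (induction k arbitrary: c)
  case (Suc k)
  show ?case by (rule Ck_SucI[where f' = "\<lambda>x v. 0"]) (auto intro: Suc)
qed auto

lemma Ck_add: "Ck k f \<Longrightarrow> Ck k g \<Longrightarrow> Ck k (\<lambda>x. f x + g x)"
proof (induction k arbitrary: f g)
  case (Suc k)
  note D = Ck_SucD[OF Suc.prems(1)] Ck_SucD[OF Suc.prems(2)]
  show ?case
    by (rule Ck_SucI[OF has_derivative_add[OF D(1) D(3)]]) (intro Suc.IH D)
qed (auto intro: continuous_intros)

lemma Ck_mult: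
  fixes f g :: "'a::real_normed_vector \<Rightarrow> 'b::real_normed_algebra"
  shows "Ck k f \<Longrightarrow> Ck k g \<Longrightarrow> Ck k (\<lambda>x. f x * g x)"
proof (induction k arbitrary: f g)
  case (Suc k)
  note D = Ck_SucD[OF Suc.prems(1)] Ck_SucD[OF Suc.prems(2)]
  show ?case
    by (rule Ck_SucI[OF has_derivative_mult[OF D(1) D(3)]])
       (intro Ck_add Suc.IH D(2,4) Suc.prems[THEN Ck_Suc_imp])
qed (auto intro: continuous_intros)

lemma Ck_bounded_linear:
  assumes B: "bounded_linear B"
  shows "Ck k f \<Longrightarrow> Ck k (\<lambda>x. B (f x))"
proof (induction k arbitrary: f)
  case 0
  then show ?case by (simp add: bounded_linear.continuous_on[OF B])
next
  case (Suc k)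
  note D = Ck_SucD[OF Suc.prems(1)]
  show ?case
    by (rule Ck_SucI[OF bounded_linear.has_derivative[OF B D(1)]]) (intro Suc.IH D)
qed

lemma Ck_affine:
  assumes A: "bounded_linear A"
  shows "Ck k f \<Longrightarrow> Ck k (\<lambda>x. f (A x + t))"
proof (induction k arbitrary: f)
  case 0
  then show ?case
    by (auto intro!: continuous_on_compose2[of UNIV f] continuous_intros bounded_linear.continuous_on[OF A])
next
  case (Suc k)
  note D = Ck_SucD[OF Suc.prems(1)]
  have "((\<lambda>x. A x + t) has_derivative (\<lambda>v. A v + 0)) (at x)" for x
    by (intro has_derivative_add bounded_linear_imp_has_derivative A has_derivative_const)
  then have "((\<lambda>x. f (A x + t)) has_derivative (\<lambda>v. frechet_derivative f (at (A x + t)) (A v + 0))) (at x)" for x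
    by (rule has_derivative_compose) (rule D)
  then show ?case
  proof (rule Ck_SucI)
    fix v
    show "Ck k (\<lambda>x. frechet_derivative f (at (A x + t)) (A v + 0))"
      using Suc.IH[OF D(2)[of "A v + 0"]] .
  qed
qed

lemma Ck_prod:
  fixes f :: "'i \<Rightarrow> 'a::real_normed_vector \<Rightarrow> real"
  assumes "\<And>i. i \<in> I \<Longrightarrow> Ck k (f i)"
  shows "Ck k (\<lambda>x. \<Prod>i\<in>I. f i x)"
  using assms
proof (induction I rule: infinite_finite_induct)
  case (insert i I)
  then show ?case using Ck_mult[of k "f i" "\<lambda>x. \<Prod>i\<in>I. f i x"] by (simp del: Ck.simps)
next
  case (infinite I)
  then show ?case using Ck_const[of k "1::real"] by (simp del: Ck.simps)
next
  case empty
  then show ?case using Ck_const[of k "1::real"] by (simp del: Ck.simps)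
qed

section \<open>Iterated averages and their Fourier transforms\<close>

definition lip_bump :: "real \<Rightarrow> real \<Rightarrow> (real \<Rightarrow> real) \<Rightarrow> bool" where
  "lip_bump L r g \<longleftrightarrow> L-lipschitz_on UNIV g \<and> (\<forall>t. 0 \<le> g t) \<and> (\<forall>t. \<bar>t\<bar> > r \<longrightarrow> g t = 0)"

lemma lip_bumpD:
  assumes "lip_bump L r g"
  shows "L-lipschitz_on UNIV g" "\<And>t. 0 \<le> g t" "\<And>t. \<bar>t\<bar> > r \<Longrightarrow> g t = 0"
    "g \<in> borel_measurable borel" "L \<ge> 0" "continuous_on UNIV g"
proof -
  show 1: "L-lipschitz_on UNIV g" and "\<And>t. 0 \<le> g t" and "\<And>t. \<bar>t\<bar> > r \<Longrightarrow> g t = 0"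
    using assms unfolding lip_bump_def by blast+
  show "g \<in> borel_measurable borel" by (rule lipschitz_borel[OF 1])
  show "L \<ge> 0" by (rule lipschitz_on_nonneg[OF 1])
  show "continuous_on UNIV g" by (rule lipschitz_on_continuous_on[OF 1])
qed

lemma lip_bump_mono: "lip_bump L r g \<Longrightarrow> r \<le> s \<Longrightarrow> lip_bump L s g"
  by (auto simp: lip_bump_def)

lemma lip_bump_box_avg: "lip_bump L r g \<Longrightarrow> a \<ge> 0 \<Longrightarrow> lip_bump L (r + a) (box_avg a g)"
  unfolding lip_bump_def by (intro conjI allI impI box_avg_lipschitz box_avg_nonneg box_avg_support[of r g]) auto

lemma lip_bump_integrable:
  assumes g: "lip_bump L r g"
  shows "integrable lborel g"
proof -
  have "integrable lborel (\<lambda>t. indicator {-r..r} t *\<^sub>R g t)"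
    by (rule borel_integrable_compact) (use lip_bumpD(6)[OF g] in \<open>auto intro: continuous_on_subset\<close>)
  also have "(\<lambda>t. indicator {-r..r} t *\<^sub>R g t) = g"
  proof
    show "indicator {-r..r} t *\<^sub>R g t = g t" for t
      using lip_bumpD(3)[OF g, of t] by (auto split: split_indicator)
  qed
  finally show ?thesis .
qed

lemma lip_bump_bound:
  assumes g: "lip_bump L r g" and "r \<ge> 0"
  shows "g t \<le> L * (2 * r + 1)"
proof (cases "\<bar>t\<bar> > r")
  case True
  then show ?thesis using lip_bumpD(3,5)[OF g] assms(2) by simp
next
  case False
  have "\<bar>g t - g (r + 1)\<bar> \<le> L * \<bar>t - (r + 1)\<bar>"
    by (rule lipschitz_abs) (rule lip_bumpD(1)[OF g])
  also have "\<dots> \<le> L * (2 * r + 1)"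
    using False lip_bumpD(5)[OF g] by (intro mult_left_mono) auto
  finally show ?thesis using lip_bumpD(3)[OF g, of "r + 1"] assms(2) by simp
qed

text \<open>
  The Fourier transform on the line, with \<open>cis\<close> in place of the complex exponential so
  that its modulus simplifies to one.
\<close>

definition fourier1 :: "(real \<Rightarrow> real) \<Rightarrow> real \<Rightarrow> complex" where
  "fourier1 g s = (LINT t|lborel. of_real (g t) * cis (- (2 * pi * s * t)))"

lemma continuous_on_cis [continuous_intros]:
  "continuous_on S f \<Longrightarrow> continuous_on S (\<lambda>x. cis (f x))"
  by (simp add: cis_conv_exp continuous_intros)

lemma cis_measurable [measurable]:
  "f \<in> borel_measurable M \<Longrightarrow> (\<lambda>x. cis (f x)) \<in> borel_measurable M"
  by (erule measurable_compose)
     (intro borel_measurable_continuous_onI continuous_on_cis continuous_on_id)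

text \<open>
  This is \<open>sin (2 pi x) / (2 pi x)\<close>, the characteristic function of the uniform
  distribution.
\<close>

definition sinc_factor :: "real \<Rightarrow> complex" where
  "sinc_factor x = (LINT u|unif. cis (2 * pi * x * u))"

lemma norm_sinc_factor_le_1: "norm (sinc_factor x) \<le> 1"
proof -
  have "norm (sinc_factor x) \<le> (LINT u|unif. norm (cis (2 * pi * x * u)))"
    unfolding sinc_factor_def by (rule integral_norm_bound)
  then show ?thesis by (simp add: unif.prob_space[simplified])
qed

text \<open>
  The closed form of the integral gives the bound \<open>1 / (2 pi |x|)\<close>, and \<open>e \<le>
  3 < 2 pi\<close>. The threshold one and the bound \<open>1 / e\<close> are what is counted in the
  decay of the kernel below.
\<close>

lemma norm_sinc_factor_le:
  assumes "\<bar>x\<bar> \<ge> 1"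
  shows "norm (sinc_factor x) \<le> exp (-1)"
proof -
  let ?F = "\<lambda>u. cis (2 * pi * x * u) / (\<i> * (2 * pi * x))"
  have x: "x \<noteq> 0" using assms by auto
  have "(LINT u|lborel. indicator {-1..1} u *\<^sub>R cis (2 * pi * x * u)) = ?F 1 - ?F (-1)"
  proof (rule integral_FTC_Icc)
    fix u :: real
    have "((\<lambda>z. exp (\<i> * (2 * pi * x) * z) / (\<i> * (2 * pi * x))) has_field_derivative
        exp (\<i> * (2 * pi * x) * of_real u)) (at (of_real u))"
      using x by (auto intro!: derivative_eq_intros)
    from has_vector_derivative_real_field[OF this]
    show "(?F has_vector_derivative cis (2 * pi * x * u)) (at u within {-1..1})"
      by (simp add: cis_conv_exp mult_ac)
  qed (auto intro!: continuous_intros)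
  then have eq: "sinc_factor x = (1/2) * (?F 1 - ?F (-1))"
    by (simp add: sinc_factor_def integral_unif scaleR_conv_of_real)
  have "norm (sinc_factor x) \<le> (1/2) * (norm (?F 1) + norm (?F (-1)))"
    unfolding eq norm_mult using norm_triangle_ineq4[of "?F 1" "?F (-1)"] by simp
  also have "\<dots> = 1 / (2 * pi * \<bar>x\<bar>)"
    by (simp add: norm_divide norm_mult)
  also have "\<dots> \<le> 1 / (2 * pi * 1)"
    using assms by (intro divide_left_mono mult_left_mono) auto
  also have "\<dots> \<le> 1 / exp 1"
    using exp_le pi_gt3 by (intro divide_left_mono) auto
  finally show ?thesis by (simp add: exp_minus inverse_eq_divide)
qed

text \<open>
  An average is a convolution with a uniform distribution, so its transform acquires the
  corresponding factor: exchange the two integrals and translate.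
\<close>

lemma fourier1_box_avg:
  assumes g: "lip_bump L r g" and a: "a \<ge> 0"
  shows "fourier1 (box_avg a g) s = sinc_factor (a * s) * fourier1 g s"
proof -
  interpret lu: pair_sigma_finite lborel unif
    by (intro pair_sigma_finite.intro sigma_finite_lborel unif.sigma_finite_measure_axioms)
  note [measurable] = lip_bumpD(4)[OF g]
  let ?f = "\<lambda>t u. of_real (g (t + a * u)) * cis (- (2 * pi * s * t))"
  have int: "integrable (lborel \<Otimes>\<^sub>M unif) (case_prod ?f)"
  proof (rule lu.Fubini_integrable)
    show "case_prod ?f \<in> borel_measurable (lborel \<Otimes>\<^sub>M unif)" by measurable
    have "integrable lborel (box_avg a g)"
      by (rule lip_bump_integrable[OF lip_bump_box_avg[OF g a]])
    then show "integrable lborel (\<lambda>t. LINT u|unif. norm (case_prod ?f (t, u)))"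
      using lip_bumpD(2)[OF g] by (simp add: norm_mult box_avg_def[abs_def])
    show "AE t in lborel. integrable unif (\<lambda>u. case_prod ?f (t, u))"
      using integrable_box_avg[OF lip_bumpD(1)[OF g]] by simp
  qed
  have "fourier1 (box_avg a g) s = (LINT t|lborel. LINT u|unif. ?f t u)"
    unfolding fourier1_def box_avg_def by (simp add: integral_complex_of_real)
  also have "\<dots> = (LINT u|unif. LINT t|lborel. ?f t u)"
    using lu.Fubini_integral[OF int] by simp
  also have "\<dots> = (LINT u|unif. cis (2 * pi * (a * s) * u) * fourier1 g s)"
  proof (intro Bochner_Integration.integral_cong refl)
    fix u
    show "(LINT t|lborel. ?f t u) = cis (2 * pi * (a * s) * u) * fourier1 g s"
  proof -
    have "fourier1 g s = (LINT t|lborel. of_real (g (a * u + 1 * t)) * cis (- (2 * pi * s * (a * u + 1 * t))))"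
      unfolding fourier1_def by (subst lborel_integral_real_affine[where c = 1 and t = "a * u"]) simp_all
    also have "\<dots> = (LINT t|lborel. cis (- (2 * pi * (a * s) * u)) * ?f t u)"
    proof (intro Bochner_Integration.integral_cong refl)
      fix t
      have "cis (- (2 * pi * s * (a * u + 1 * t))) = cis (- (2 * pi * (a * s) * u)) * cis (- (2 * pi * s * t))"
        by (simp add: cis_mult algebra_simps)
      then show "of_real (g (a * u + 1 * t)) * cis (- (2 * pi * s * (a * u + 1 * t)))
          = cis (- (2 * pi * (a * s) * u)) * ?f t u"
        by (simp add: mult_ac add_ac)
    qed
    also have "\<dots> = cis (- (2 * pi * (a * s) * u)) * (LINT t|lborel. ?f t u)"
      by simp
    finally show ?thesis by (simp add: mult.assoc[symmetric] cis_mult)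
  qed
  qed
  finally show ?thesis by (simp add: sinc_factor_def)
qed

text \<open>
  The outermost average uses the first width and the remaining ones use the shifted sequence. With
  this order the limit satisfies a recursion (\<open>limit_avg_unfold\<close>) along which
  derivatives can be counted.
\<close>

primrec iter_avg :: "(real \<Rightarrow> real) \<Rightarrow> nat \<Rightarrow> (nat \<Rightarrow> real) \<Rightarrow> real \<Rightarrow> real" where
  "iter_avg b 0 a = b"
| "iter_avg b (Suc n) a = box_avg (a 0) (iter_avg b n (\<lambda>i. a (Suc i)))"

lemma lip_bump_iter_avg:
  assumes "lip_bump L w b" "\<And>i. a i \<ge> 0"
  shows "lip_bump L (w + (\<Sum>i<n. a i)) (iter_avg b n a)"
  using assms(2)
proof (induction n arbitrary: a)
  case (Suc n)
  have "lip_bump L (w + (\<Sum>i<n. a (Suc i)) + a 0) (iter_avg b (Suc n) a)"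
    by (auto intro!: lip_bump_box_avg Suc)
  then show ?case by (simp add: sum.lessThan_Suc_shift add_ac del: sum.lessThan_Suc iter_avg.simps)
qed (use assms in auto)

lemma fourier1_iter_avg:
  assumes "lip_bump L w b" "\<And>i. a i \<ge> 0"
  shows "fourier1 (iter_avg b n a) s = (\<Prod>i<n. sinc_factor (a i * s)) * fourier1 b s"
  using assms(2)
proof (induction n arbitrary: a)
  case (Suc n)
  have "fourier1 (iter_avg b (Suc n) a) s = sinc_factor (a 0 * s) * fourier1 (iter_avg b n (\<lambda>i. a (Suc i))) s"
    using Suc.prems by (auto intro!: fourier1_box_avg lip_bump_iter_avg assms(1))
  then show ?case
    using Suc by (simp add: prod.lessThan_Suc_shift mult_ac del: prod.lessThan_Suc iter_avg.simps)
qed auto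

text \<open>
  The additional average is the innermost one. It moves the bump by at most \<open>L * a n\<close>,
  and the outer averages are contractions for the supremum norm.
\<close>

lemma iter_avg_step:
  assumes "lip_bump L w b" "\<And>i. a i \<ge> 0"
  shows "\<bar>iter_avg b (Suc n) a t - iter_avg b n a t\<bar> \<le> L * a n"
  using assms(2)
proof (induction n arbitrary: a t)
  case 0
  then show ?case using box_avg_near[OF lip_bumpD(1)[OF assms(1)]] by simp
next
  case (Suc n)
  have "\<bar>box_avg (a 0) (iter_avg b (Suc n) (\<lambda>i. a (Suc i))) t - box_avg (a 0) (iter_avg b n (\<lambda>i. a (Suc i))) t\<bar> \<le> L * a (Suc n)"
    by (rule box_avg_diff_le[OF lip_bumpD(1)[OF lip_bump_iter_avg[OF assms(1)]] lip_bumpD(1)[OF lip_bump_iter_avg[OF assms(1)]]])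
       (use Suc.IH[of "\<lambda>i. a (Suc i)"] Suc.prems in \<open>auto simp del: iter_avg.simps\<close>)
  then show ?case by (simp only: iter_avg.simps)
qed

definition limit_avg :: "(real \<Rightarrow> real) \<Rightarrow> (nat \<Rightarrow> real) \<Rightarrow> real \<Rightarrow> real" where
  "limit_avg b a t = lim (\<lambda>n. iter_avg b n a t)"

lemma limit_avg:
  assumes "lip_bump L w b" "\<And>i. a i \<ge> 0" "summable a"
  shows "(\<lambda>n. iter_avg b n a t) \<longlonglongrightarrow> limit_avg b a t"
proof -
  have "summable (\<lambda>n. iter_avg b (Suc n) a t - iter_avg b n a t)"
    by (rule summable_comparison_test'[OF summable_mult[OF assms(3), of L]])
       (use iter_avg_step[OF assms(1,2)] in auto)
  then have "convergent (\<lambda>n. \<Sum>i<n. iter_avg b (Suc i) a t - iter_avg b i a t)"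
    by (simp add: summable_iff_convergent del: iter_avg.simps)
  then have "convergent (\<lambda>n. iter_avg b n a t - iter_avg b 0 a t)"
    using sum_lessThan_telescope[of "\<lambda>n. iter_avg b n a t"] by (simp del: iter_avg.simps)
  then have "convergent (\<lambda>n. (iter_avg b n a t - iter_avg b 0 a t) + iter_avg b 0 a t)"
    by (intro convergent_add convergent_const)
  then show ?thesis unfolding limit_avg_def by (simp add: convergent_LIMSEQ_iff)
qed

lemma lip_bump_iter_avg_uniform:
  assumes "lip_bump L w b" "\<And>i. a i \<ge> 0" "summable a"
  shows "lip_bump L (w + suminf a) (iter_avg b n a)"
  by (rule lip_bump_mono[OF lip_bump_iter_avg[OF assms(1,2)]]) (use assms in \<open>auto intro: sum_le_suminf\<close>)

lemma lip_bump_limit_avg: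
  assumes "lip_bump L w b" "\<And>i. a i \<ge> 0" "summable a"
  shows "lip_bump L (w + suminf a) (limit_avg b a)"
  unfolding lip_bump_def
proof (intro conjI allI impI)
  note c = lip_bump_iter_avg_uniform[OF assms] and l = limit_avg[OF assms]
  show "L-lipschitz_on UNIV (limit_avg b a)"
  proof (rule lipschitz_onI)
    show "dist (limit_avg b a s) (limit_avg b a t) \<le> L * dist s t" for s t
      by (rule Lim_bounded[OF tendsto_dist[OF l l]]) (use lipschitz_onD[OF lip_bumpD(1)[OF c]] in auto)
  qed (use lip_bumpD(5)[OF assms(1)] in auto)
  show "0 \<le> limit_avg b a t" for t
    by (rule LIMSEQ_le_const[OF l]) (use lip_bumpD(2)[OF c] in auto)
  show "limit_avg b a t = 0" if "\<bar>t\<bar> > w + suminf a" for t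
    using l[of t] lip_bumpD(3)[OF c that] by (simp add: LIMSEQ_const_iff)
qed

text \<open>
  Pass to the limit in the recursion of the iterated averages; the average commutes with the limit
  by dominated convergence, since all iterates share one Lipschitz constant and one support.
\<close>

lemma limit_avg_unfold:
  assumes "lip_bump L w b" "w \<ge> 0" "\<And>i. a i \<ge> 0" "summable a"
  shows "limit_avg b a = box_avg (a 0) (limit_avg b (\<lambda>i. a (Suc i)))"
proof
  fix t
  let ?a = "\<lambda>i. a (Suc i)"
  have a: "\<And>i. ?a i \<ge> 0" "summable ?a" using assms(3,4) by (auto simp: summable_Suc_iff)
  let ?B = "L * (2 * (w + suminf ?a) + 1)"
  note c = lip_bump_iter_avg_uniform[OF assms(1) a]
  note [measurable] = lip_bumpD(4)[OF c] lip_bumpD(4)[OF lip_bump_limit_avg[OF assms(1) a]]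
  have W: "w + suminf ?a \<ge> 0" using assms(2) suminf_nonneg[OF a(2,1)] by simp
  have "(\<lambda>n. box_avg (a 0) (iter_avg b n ?a) t) \<longlonglongrightarrow> box_avg (a 0) (limit_avg b ?a) t"
    unfolding box_avg_def
  proof (rule integral_dominated_convergence[where w = "\<lambda>_. ?B"])
    show "AE u in unif. norm (iter_avg b n ?a (t + a 0 * u)) \<le> ?B" for n
      using lip_bump_bound[OF c W] lip_bumpD(2)[OF c] by simp
  qed (use limit_avg[OF assms(1) a] in auto)
  moreover have "(\<lambda>n. box_avg (a 0) (iter_avg b n ?a) t) \<longlonglongrightarrow> limit_avg b a t"
    using LIMSEQ_Suc[OF limit_avg[OF assms(1,3,4), of t]] by simp
  ultimately show "limit_avg b a t = box_avg (a 0) (limit_avg b ?a) t"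
    by (rule LIMSEQ_unique[rotated])
qed

text \<open>
  One average is split off for each derivative: the derivative is a combination of translates of the
  limit belonging to the shifted widths, which has the same form again.
\<close>

lemma Ck_limit_avg:
  assumes "lip_bump L w b" "w \<ge> 0" "\<And>i. a i > 0" "summable a"
  shows "Ck k (limit_avg b a)"
  using assms(3,4)
proof (induction k arbitrary: a)
  case 0
  show ?case
    using lip_bumpD(6)[OF lip_bump_limit_avg[OF assms(1) less_imp_le[OF 0(1)] 0(2)]] by simp
next
  case (Suc k)
  let ?r = "limit_avg b (\<lambda>i. a (Suc i))"
  have C: "Ck k' ?r" if "k' \<le> k" for k' 
    using that by (induction rule: inc_induct) (use Suc in \<open>auto intro: Ck_Suc_imp simp: summable_Suc_iff\<close>)
  have eq: "limit_avg b a = box_avg (a 0) ?r"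
    by (rule limit_avg_unfold[OF assms(1,2) less_imp_le[OF Suc(2)] Suc(3)])
  have "continuous_on UNIV ?r" using C[of 0] by simp
  then have "((box_avg (a 0) ?r) has_real_derivative (?r (t + a 0) - ?r (t - a 0)) / (2 * a 0)) (at t)" for t
    by (rule box_avg_has_derivative) (rule Suc(2))
  then have "((box_avg (a 0) ?r) has_derivative (\<lambda>v. (?r (t + a 0) - ?r (t - a 0)) / (2 * a 0) * v)) (at t)" for t
    unfolding has_field_derivative_def .
  then show ?case
    unfolding eq
  proof (rule Ck_SucI)
    fix v :: real
    have "Ck k (\<lambda>t. v / (2 * a 0) * ?r (t + a 0) + (- v / (2 * a 0)) * ?r (t + (- a 0)))"
      by (intro Ck_add Ck_bounded_linear[OF bounded_linear_mult_right] Ck_affine[OF bounded_linear_ident] C) auto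
    then show "Ck k (\<lambda>t. (?r (t + a 0) - ?r (t - a 0)) / (2 * a 0) * v)"
      by (simp add: algebra_simps diff_divide_distrib)
  qed
qed

lemma norm_fourier1_le:
  assumes "lip_bump L r g"
  shows "norm (fourier1 g s) \<le> (LINT t|lborel. g t)"
proof -
  have "norm (fourier1 g s) \<le> (LINT t|lborel. norm (of_real (g t) * cis (- (2 * pi * s * t))))"
    unfolding fourier1_def by (rule integral_norm_bound)
  then show ?thesis using lip_bumpD(2)[OF assms] by (simp add: norm_mult)
qed

lemma fourier1_limit_avg:
  assumes "lip_bump L w b" "w \<ge> 0" "\<And>i. a i \<ge> 0" "summable a"
  shows "(\<lambda>n. (\<Prod>i<n. sinc_factor (a i * s)) * fourier1 b s) \<longlonglongrightarrow> fourier1 (limit_avg b a) s"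
proof -
  let ?W = "w + suminf a"
  let ?B = "L * (2 * ?W + 1)"
  note c = lip_bump_iter_avg_uniform[OF assms(1,3,4)]
  note [measurable] = lip_bumpD(4)[OF c] lip_bumpD(4)[OF lip_bump_limit_avg[OF assms(1,3,4)]]
  have W: "?W \<ge> 0" using assms(2) suminf_nonneg[OF assms(4,3)] by simp
  have "(\<lambda>n. fourier1 (iter_avg b n a) s) \<longlonglongrightarrow> fourier1 (limit_avg b a) s"
    unfolding fourier1_def
  proof (rule integral_dominated_convergence[where w = "\<lambda>t. indicator {-?W..?W} t * ?B"])
    show "integrable lborel (\<lambda>t. indicator {-?W..?W} t * ?B)"
      by (intro integrable_mult_left integrable_real_indicator) (auto simp: emeasure_lborel_Icc_eq)
    show "AE t in lborel. (\<lambda>n. of_real (iter_avg b n a t) * cis (- (2 * pi * s * t)))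
        \<longlonglongrightarrow> of_real (limit_avg b a t) * cis (- (2 * pi * s * t))"
      by (intro AE_I2 tendsto_intros limit_avg[OF assms(1,3,4)])
    show "AE t in lborel. norm (of_real (iter_avg b n a t) * cis (- (2 * pi * s * t))) \<le> indicator {-?W..?W} t * ?B" for n
      using lip_bump_bound[OF c W] lip_bumpD(2,3)[OF c] by (auto simp: norm_mult split: split_indicator)
  qed measurable
  then show ?thesis using fourier1_iter_avg[OF assms(1,3)] by simp
qed

text \<open>
  All factors have modulus at most one, so any finite number of them may be kept as a bound for the
  full product.
\<close>

lemma norm_fourier1_limit_avg_le:
  assumes "lip_bump L w b" "w \<ge> 0" "\<And>i. a i \<ge> 0" "summable a" and "(LINT t|lborel. b t) = 1"
  shows "norm (fourier1 (limit_avg b a) s) \<le> (\<Prod>i<n. norm (sinc_factor (a i * s)))"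
proof (rule Lim_bounded[OF tendsto_norm[OF fourier1_limit_avg[OF assms(1-4)]], of n])
  show "\<forall>m\<ge>n. norm ((\<Prod>i<m. sinc_factor (a i * s)) * fourier1 b s) \<le> (\<Prod>i<n. norm (sinc_factor (a i * s)))"
  proof (intro allI impI)
    fix m assume "n \<le> m"
    have "(\<Prod>i<m. norm (sinc_factor (a i * s))) \<le> (\<Prod>i<n. norm (sinc_factor (a i * s)))"
      using \<open>n \<le> m\<close>
    proof (induction m rule: dec_induct)
      case (step m)
      have "(\<Prod>i<Suc m. norm (sinc_factor (a i * s))) \<le> (\<Prod>i<m. norm (sinc_factor (a i * s))) * 1"
        by (simp del: mult_1_right, intro mult_left_mono norm_sinc_factor_le_1 prod_nonneg) auto
      then show ?case using step by simp
    qed simp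
    then have "(\<Prod>i<m. norm (sinc_factor (a i * s))) * norm (fourier1 b s) \<le> (\<Prod>i<n. norm (sinc_factor (a i * s))) * 1"
      by (intro mult_mono prod_nonneg) (use norm_fourier1_le[OF assms(1), of s] assms(5) in auto)
    then show "norm ((\<Prod>i<m. sinc_factor (a i * s)) * fourier1 b s) \<le> (\<Prod>i<n. norm (sinc_factor (a i * s)))"
      by (simp add: norm_mult prod_norm)
  qed
qed

lemma integral_limit_avg:
  assumes "lip_bump L w b" "w \<ge> 0" "\<And>i. a i \<ge> 0" "summable a" and "(LINT t|lborel. b t) = 1"
  shows "(LINT t|lborel. limit_avg b a t) = 1"
proof -
  have "sinc_factor 0 = 1" by (simp add: sinc_factor_def unif.prob_space[simplified])
  moreover have 0: "fourier1 g 0 = of_real (LINT t|lborel. g t)" for g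
    by (simp add: fourier1_def integral_complex_of_real)
  ultimately have "fourier1 (limit_avg b a) 0 = 1"
    using fourier1_limit_avg[OF assms(1-4), of 0] assms(5) by (simp add: LIMSEQ_const_iff)
  then show ?thesis unfolding 0 by (metis of_real_eq_1_iff)
qed

lemma ex_normalized_lip_bump:
  assumes w: "w > 0"
  shows "\<exists>L b. lip_bump L w b \<and> (LINT t|lborel. b t) = 1"
proof -
  let ?g = "\<lambda>t. max 0 (w - \<bar>t\<bar>)"
  have g: "lip_bump 1 w ?g"
    unfolding lip_bump_def by (auto intro!: lipschitz_onI simp: dist_real_def)
  let ?c = "LINT t|lborel. ?g t"
  \<comment> \<open>The triangle of height and half-width \<open>w\<close> is at least \<open>w/2\<close> on the middle half of its support.\<close>
  have "w/2 * w = (LINT t|lborel. indicator {-w/2..w/2} t * (w/2))"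
    using w by simp
  also have "\<dots> \<le> ?c"
    using w by (intro integral_mono lip_bump_integrable[OF g] integrable_mult_left integrable_real_indicator)
       (auto split: split_indicator)
  finally have c: "?c > 0" using w by (smt (verit) mult_pos_pos half_gt_zero)
  have "lip_bump (1 / ?c) w (\<lambda>t. ?g t / ?c)"
    unfolding lip_bump_def
  proof (intro conjI)
    show "(1 / ?c)-lipschitz_on UNIV (\<lambda>t. ?g t / ?c)"
    proof (rule lipschitz_onI)
      fix x y :: real
      have "\<bar>?g x - ?g y\<bar> / ?c \<le> \<bar>x - y\<bar> / ?c"
        using c by (intro divide_right_mono) auto
      then show "dist (?g x / ?c) (?g y / ?c) \<le> 1 / ?c * dist x y"
        using c by (simp add: dist_real_def flip: diff_divide_distrib)
    qed (use c in auto)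
  qed (use c in auto)
  moreover have "(LINT t|lborel. ?g t / ?c) = 1" using c by simp
  ultimately show ?thesis by blast
qed

section \<open>Kernels with prescribed Fourier decay\<close>

text \<open>
  The widths are \<open>\<psi> j / j\<close>, where \<open>\<psi>\<close> is a positive perturbation
  of \<open>\<phi>\<close>, started at an index \<open>N0\<close> so large that their sum is below
  \<open>\<delta> / 2\<close> and that \<open>\<psi> \<le> 1\<close> from there on. For a frequency
  \<open>r \<ge> N0\<close> and \<open>n = \<lfloor>r \<psi> r\<rfloor> \<le> r\<close>, every index
  \<open>j \<le> n\<close> satisfies \<open>r \<psi> j / j \<ge> r \<psi> r / n \<ge> 1\<close>, so
  the \<open>n - N0\<close> factors belonging to \<open>N0 \<le> j < n\<close> contribute \<open>exp
  (- (n - N0))\<close>. The indices lost by the shift and the frequencies below \<open>N0\<close>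
  are absorbed in the constant.
\<close>

lemma fast_decaying_kernel:
  fixes \<phi> :: "real \<Rightarrow> real"
  assumes anti: "antimono_on {0..} \<phi>" and nonneg: "\<And>r. r \<ge> 0 \<Longrightarrow> \<phi> r \<ge> 0"
    and summ: "summable (\<lambda>k. \<phi> (2 ^ k))" and d: "\<delta> > 0"
  shows "\<exists>L \<rho> C. lip_bump L \<delta> \<rho> \<and> (LINT t|lborel. \<rho> t) = 1 \<and> (\<forall>k. Ck k \<rho>) \<and> C \<ge> 1 \<and>
    (\<forall>s. norm (fourier1 \<rho> s) \<le> C * exp (- \<phi> \<bar>s\<bar> * \<bar>s\<bar>))"
proof -
  \<comment> \<open>The added term keeps the widths positive even where \<open>\<phi>\<close> is zero.\<close>
  define \<psi> where "\<psi> r = \<phi> r + 1 / (1 + r)" for r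
  have anti\<phi>: "\<phi> s \<le> \<phi> r" if "0 \<le> r" "r \<le> s" for r s
    using anti that by (auto simp: monotone_on_def)
  have anti\<psi>: "\<psi> s \<le> \<psi> r" if "0 \<le> r" "r \<le> s" for r s
    unfolding \<psi>_def using that by (intro add_mono anti\<phi> divide_left_mono) auto
  have pos\<psi>: "\<psi> r > 0" if "0 \<le> r" for r
    unfolding \<psi>_def using nonneg[OF that] that by (intro add_nonneg_pos) auto
  define c where "c m = \<psi> (real m) / real m" for m :: nat
  have "summable (\<lambda>k. \<psi> (2 ^ k))"
    unfolding \<psi>_def
  proof (intro summable_add summ)
    show "summable (\<lambda>k. 1 / (1 + 2 ^ k :: real))"
    proof (rule summable_comparison_test'[of "\<lambda>k. (1/2) ^ k"])
      fix k :: nat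
      have "1 / (1 + 2 ^ k :: real) \<le> 1 / 2 ^ k"
        by (intro divide_left_mono mult_pos_pos add_pos_pos) auto
      moreover have "0 \<le> 1 / (1 + 2 ^ k :: real)" by (intro divide_nonneg_pos add_pos_pos) auto
      ultimately show "norm (1 / (1 + 2 ^ k :: real)) \<le> (1/2) ^ k"
        by (simp only: real_norm_def abs_of_nonneg power_one_over)
    qed (simp add: summable_geometric)
  qed
  then have "summable c"
    by (subst condensation_test)
       (auto simp: c_def intro!: frac_le anti\<psi> divide_nonneg_nonneg less_imp_le[OF pos\<psi>])
  from suminf_exist_split[OF _ this, of "\<delta>/2"] d
  obtain N where N: "\<And>n. n \<ge> N \<Longrightarrow> norm (\<Sum>i. c (i + n)) < \<delta>/2" by auto
  have "(\<lambda>k. \<psi> (2 ^ k)) \<longlonglongrightarrow> 0"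
    using \<open>summable (\<lambda>k. \<psi> (2 ^ k))\<close> by (rule summable_LIMSEQ_zero)
  then have "eventually (\<lambda>k. \<psi> (2 ^ k) < 1) sequentially"
    by (rule order_tendstoD) simp
  then obtain K where K: "\<psi> (2 ^ K) < 1" by (auto simp: eventually_sequentially)
  define N0 where "N0 = Suc (max N (2 ^ K))"
  have N0: "N0 > 0" "N0 \<ge> N" "real N0 \<ge> 2 ^ K"
    by (auto simp: N0_def intro: order.trans[of _ "real (max N (2 ^ K))"])
  define a where "a i = c (i + N0)" for i
  have a_pos: "a i > 0" for i
    using N0(1) by (auto simp: a_def c_def intro!: divide_pos_pos pos\<psi>)
  have a_sum: "summable a"
    unfolding a_def using \<open>summable c\<close> by (simp add: summable_iff_shift)
  have a_lt: "suminf a < \<delta>/2"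
    using N[OF N0(2)] unfolding a_def by simp
  from ex_normalized_lip_bump[of "\<delta>/2"] d obtain L b where b: "lip_bump L (\<delta>/2) b" "(LINT t|lborel. b t) = 1" by auto
  let ?\<rho> = "limit_avg b a"
  let ?C = "exp (real N0 + 1 + real N0 * \<phi> 0)"
  have w: "0 \<le> \<delta>/2" using d by simp
  have 1: "lip_bump L \<delta> ?\<rho>"
    by (rule lip_bump_mono[OF lip_bump_limit_avg[OF b(1) less_imp_le[OF a_pos] a_sum]]) (use a_lt in simp)
  have 2: "(LINT t|lborel. ?\<rho> t) = 1"
    by (rule integral_limit_avg[OF b(1) w less_imp_le[OF a_pos] a_sum b(2)])
  have 3: "Ck k ?\<rho>" for k
    by (rule Ck_limit_avg[OF b(1) w a_pos a_sum])
  have 4: "norm (fourier1 ?\<rho> s) \<le> ?C * exp (- \<phi> \<bar>s\<bar> * \<bar>s\<bar>)" for s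
  proof (cases "\<bar>s\<bar> < real N0")
    case True
    have "norm (fourier1 ?\<rho> s) \<le> exp 0"
      using norm_fourier1_le[OF 1, of s] 2 by simp
    also have "\<phi> \<bar>s\<bar> * \<bar>s\<bar> \<le> \<phi> 0 * real N0"
      using True nonneg[of 0] nonneg[of "\<bar>s\<bar>"] by (intro mult_mono anti\<phi>) auto
    then have "exp 0 \<le> exp (real N0 + 1 + real N0 * \<phi> 0 + (- \<phi> \<bar>s\<bar> * \<bar>s\<bar>))"
      by (subst exp_le_cancel_iff) (simp add: mult_ac)
    finally show ?thesis by (simp only: exp_add)
  next
    case False
    define r where "r = \<bar>s\<bar>"
    define n where "n = nat \<lfloor>r * \<psi> r\<rfloor>"
    have r: "r \<ge> 0" "r \<ge> real N0" using False by (auto simp: r_def)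
    have \<psi>1: "\<psi> r \<le> 1"
      using anti\<psi>[of "2 ^ K" r] N0(3) r K by simp
    have rp: "r * \<psi> r \<ge> 0" using r pos\<psi>[of r] by simp
    have n_le: "real n \<le> r * \<psi> r" and n_ge: "r * \<psi> r < real n + 1"
      unfolding n_def using rp by linarith+
    have "r * \<psi> r \<le> r * 1" using r \<psi>1 by (intro mult_left_mono) auto
    then have nr: "real n \<le> r" using n_le by simp
    have sg: "norm (sinc_factor (a i * s)) \<le> exp (-1)" if i: "i < n - N0" for i
    proof (rule norm_sinc_factor_le)
      define j where "j = i + N0"
      have j: "j \<le> n" "j > 0" using i N0 by (auto simp: j_def)
      have "1 \<le> real n / real j" using j by simp
      also have "\<dots> \<le> \<psi> r * r / real j"
        using n_le j by (intro divide_right_mono) (auto simp: mult_ac)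
      also have "\<dots> \<le> \<psi> (real j) * r / real j"
        using j r nr by (intro divide_right_mono mult_right_mono anti\<psi>) auto
      also have "\<dots> = \<bar>a i * s\<bar>"
        using pos\<psi>[of "real j"] by (simp add: abs_mult r_def a_def c_def j_def)
      finally show "1 \<le> \<bar>a i * s\<bar>" .
    qed
    have "norm (fourier1 ?\<rho> s) \<le> (\<Prod>i<n - N0. norm (sinc_factor (a i * s)))"
      by (rule norm_fourier1_limit_avg_le[OF b(1) w less_imp_le[OF a_pos] a_sum b(2)])
    also have "\<dots> \<le> (\<Prod>i<n - N0. exp (-1))"
      using sg by (intro prod_mono) auto
    also have "\<dots> = exp (- real (n - N0))"
      by (simp add: exp_of_nat_mult[symmetric])
    also have "\<dots> \<le> exp (real N0 + 1 + real N0 * \<phi> 0 + (- \<phi> r * r))"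
    proof (subst exp_le_cancel_iff)
      have "\<phi> r * r \<le> r * \<psi> r" using r by (simp add: \<psi>_def algebra_simps)
      moreover have "real N0 * \<phi> 0 \<ge> 0" using nonneg[of 0] by simp
      moreover have "real n \<le> real (n - N0) + real N0" by linarith
      ultimately show "- real (n - N0) \<le> real N0 + 1 + real N0 * \<phi> 0 + (- \<phi> r * r)"
        using n_ge unfolding mult_minus_left by linarith
    qed
    finally show ?thesis by (simp only: exp_add r_def)
  qed
  have "real N0 + 1 + real N0 * \<phi> 0 \<ge> 0" using nonneg[of 0] by simp
  then have 5: "?C \<ge> 1" by (simp only: one_le_exp_iff)
  show ?thesis using 1 2 3 4 5 by blast
qed

section \<open>Fourier inversion on the line\<close>

lemma fourier_std_normal:
  "(LINT x|lborel. of_real (std_normal_density x) * cis (c * x)) = of_real (exp (- c\<^sup>2 / 2))"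
proof -
  have "of_real (exp (- c\<^sup>2 / 2)) = char std_normal_distribution c"
    by (simp add: char_std_normal_distribution)
  also have "\<dots> = (LINT x|lborel. std_normal_density x *\<^sub>R iexp (c * x))"
    unfolding char_def by (rule integral_density) (auto intro!: AE_I2)
  finally show ?thesis by (simp add: cis_conv_exp scaleR_conv_of_real)
qed

lemma fourier1_measurable:
  assumes [measurable]: "g \<in> borel_measurable borel"
  shows "fourier1 g \<in> borel_measurable borel"
  unfolding fourier1_def[abs_def] by measurable

text \<open>
  The inversion integral is regularized by the Gaussian \<open>m e\<close>. Since the transform of a
  Gaussian is a Gaussian, the regularized integral equals the expectation of \<open>g\<close> at a
  normally distributed point with mean \<open>t\<close> and standard deviation proportional to
  \<open>e\<close>. Both sides converge as \<open>e\<close> tends to zero.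
\<close>

lemma fourier1_inversion:
  assumes g: "lip_bump L r g" and r: "r \<ge> 0" and int: "integrable lborel (fourier1 g)"
  shows "of_real (g t) = (LINT s|lborel. fourier1 g s * cis (2 * pi * s * t))"
proof -
  note g_meas [measurable] = lip_bumpD(4)[OF g]
  define \<epsilon> where "\<epsilon> n = inverse (real (Suc n))" for n
  have e: "\<epsilon> n > 0" for n by (simp add: \<epsilon>_def)
  have e0: "\<epsilon> \<longlonglongrightarrow> 0" unfolding \<epsilon>_def by (rule LIMSEQ_inverse_real_of_nat)
  define m where "m e s = exp (- (e * s)\<^sup>2 / 2)" for e s :: real
  have [measurable]: "(\<lambda>s. m e s) \<in> borel_measurable borel" for e
    unfolding m_def by measurable
  have m_eq: "m e s = sqrt (2 * pi) * std_normal_density (e * s)" for e s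
    by (simp add: m_def std_normal_density_def)
  have m_int: "integrable lborel (m e)" if "e > 0" for e
    unfolding m_eq[abs_def]
    using lborel_integrable_real_affine[of "std_normal_density" e 0] that
    by (auto intro!: integrable_mult_right)
  define A where "A e = (LINT s|lborel. fourier1 g s * cis (2 * pi * s * t) * of_real (m e s))" for e
  have "(\<lambda>n. A (\<epsilon> n)) \<longlonglongrightarrow> (LINT s|lborel. fourier1 g s * cis (2 * pi * s * t))"
    unfolding A_def
  proof (rule integral_dominated_convergence[where w = "\<lambda>s. norm (fourier1 g s)"])
    show "AE s in lborel. (\<lambda>n. fourier1 g s * cis (2 * pi * s * t) * of_real (m (\<epsilon> n) s)) \<longlonglongrightarrow> fourier1 g s * cis (2 * pi * s * t)"
    proof (rule AE_I2)
      fix s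
      have "(\<lambda>n. fourier1 g s * cis (2 * pi * s * t) * of_real (m (\<epsilon> n) s)) \<longlonglongrightarrow> fourier1 g s * cis (2 * pi * s * t) * of_real (exp (- (0 * s)\<^sup>2 / 2))"
        unfolding m_def by (intro tendsto_intros e0) auto
      then show "(\<lambda>n. fourier1 g s * cis (2 * pi * s * t) * of_real (m (\<epsilon> n) s)) \<longlonglongrightarrow> fourier1 g s * cis (2 * pi * s * t)"
        by simp
    qed
    show "AE s in lborel. norm (fourier1 g s * cis (2 * pi * s * t) * of_real (m (\<epsilon> n) s)) \<le> norm (fourier1 g s)" for n
      by (auto simp: norm_mult m_def intro!: mult_left_le)
  qed (use int fourier1_measurable[OF g_meas] in auto)
  moreover have "(\<lambda>n. A (\<epsilon> n)) \<longlonglongrightarrow> of_real (g t)"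
  proof -
    define B where "B e = (LINT x|lborel. std_normal_density x * g (t + (- e / (2 * pi)) * x))" for e
    have "A e = of_real (B e)" if ep: "e > 0" for e
    proof -
      let ?f = "\<lambda>s u. of_real (g u) * cis (2 * pi * (t - u) * s) * complex_of_real (m e s)"
      have int2: "integrable (lborel \<Otimes>\<^sub>M lborel) (case_prod ?f)"
      proof (rule lborel_pair.Fubini_integrable)
        show "case_prod ?f \<in> borel_measurable (lborel \<Otimes>\<^sub>M lborel)" by measurable
        show "integrable lborel (\<lambda>s. LINT u|lborel. norm (case_prod ?f (s, u)))"
          using lip_bump_integrable[OF g] m_int[OF ep] by (simp add: norm_mult)
        show "AE s in lborel. integrable lborel (\<lambda>u. case_prod ?f (s, u))"
        proof (rule AE_I2)
          fix s
          have "integrable lborel (\<lambda>u. g u * m e s)" using lip_bump_integrable[OF g] by simp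
          then show "integrable lborel (\<lambda>u. case_prod ?f (s, u))"
            by (rule Bochner_Integration.integrable_bound) (auto simp: norm_mult)
        qed
      qed
      have "A e = (LINT s|lborel. LINT u|lborel. ?f s u)"
        unfolding A_def
      proof (intro Bochner_Integration.integral_cong refl)
        fix s
        have "fourier1 g s * cis (2 * pi * s * t) * of_real (m e s) =
          (LINT u|lborel. of_real (g u) * cis (- (2 * pi * s * u)) * (cis (2 * pi * s * t) * of_real (m e s)))"
          by (simp add: fourier1_def)
        also have "\<dots> = (LINT u|lborel. ?f s u)"
          by (intro Bochner_Integration.integral_cong refl)
             (simp add: cis_mult mult.assoc[symmetric], simp add: algebra_simps cis_mult)
        finally show "fourier1 g s * cis (2 * pi * s * t) * of_real (m e s) = (LINT u|lborel. ?f s u)" .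
      qed
      also have "\<dots> = (LINT u|lborel. LINT s|lborel. ?f s u)"
        using lborel_pair.Fubini_integral[OF int2] by simp
      also have "\<dots> = (LINT u|lborel. of_real (g u * (2 * pi / e * std_normal_density (2 * pi * (t - u) / e))))"
      proof (intro Bochner_Integration.integral_cong refl)
        fix u
        let ?c = "2 * pi * (t - u)"
        have "(LINT s|lborel. cis (?c * s) * complex_of_real (m e s)) =
          \<bar>1/e\<bar> *\<^sub>R (LINT x|lborel. cis (?c * (0 + 1/e * x)) * complex_of_real (m e (0 + 1/e * x)))"
          using ep by (intro lborel_integral_real_affine) simp
        also have "(LINT x|lborel. cis (?c * (0 + 1/e * x)) * complex_of_real (m e (0 + 1/e * x))) =
           (LINT x|lborel. of_real (sqrt (2 * pi)) * (of_real (std_normal_density x) * cis (?c / e * x)))"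
          using ep by (intro Bochner_Integration.integral_cong refl) (simp add: m_eq mult_ac)
        also have "\<dots> = of_real (sqrt (2 * pi)) * of_real (exp (- (?c / e)\<^sup>2 / 2))"
          by (simp only: integral_mult_right_zero fourier_std_normal)
        also have "\<bar>1/e\<bar> *\<^sub>R (of_real (sqrt (2 * pi)) * complex_of_real (exp (- (?c / e)\<^sup>2 / 2))) =
          of_real (2 * pi / e * std_normal_density (?c / e))"
          using ep by (simp add: std_normal_density_def scaleR_conv_of_real field_simps flip: of_real_mult)
        finally have "(LINT s|lborel. cis (?c * s) * complex_of_real (m e s)) = of_real (2 * pi / e * std_normal_density (?c / e))" .
        then show "(LINT s|lborel. ?f s u) = of_real (g u * (2 * pi / e * std_normal_density (?c / e)))"
          by (simp add: mult.assoc)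
      qed
      also have "\<dots> = of_real (LINT u|lborel. g u * (2 * pi / e * std_normal_density (2 * pi * (t - u) / e)))"
        by (rule integral_complex_of_real)
      also have "(LINT u|lborel. g u * (2 * pi / e * std_normal_density (2 * pi * (t - u) / e))) =
        \<bar>- e / (2 * pi)\<bar> *\<^sub>R (LINT x|lborel. g (t + (- e / (2 * pi)) * x) *
          (2 * pi / e * std_normal_density (2 * pi * (t - (t + (- e / (2 * pi)) * x)) / e)))"
        using ep by (intro lborel_integral_real_affine) simp
      also have "\<dots> = B e"
        using ep by (simp add: B_def field_simps flip: integral_mult_right_zero)
      finally show ?thesis .
    qed
    moreover have "(\<lambda>n. B (\<epsilon> n)) \<longlonglongrightarrow> (LINT x|lborel. std_normal_density x * g t)"
      unfolding B_def
    proof (rule integral_dominated_convergence[where w = "\<lambda>x. std_normal_density x * (L * (2 * r + 1))"])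
      show "AE x in lborel. (\<lambda>n. std_normal_density x * g (t + (- \<epsilon> n / (2 * pi)) * x)) \<longlonglongrightarrow> std_normal_density x * g t"
      proof (rule AE_I2)
        fix x
        have "(\<lambda>n. t + (- \<epsilon> n / (2 * pi)) * x) \<longlonglongrightarrow> t + (- 0 / (2 * pi)) * x"
          by (intro tendsto_intros e0) auto
        then have "(\<lambda>n. g (t + (- \<epsilon> n / (2 * pi)) * x)) \<longlonglongrightarrow> g t"
          using lip_bumpD(6)[OF g] by (intro continuous_on_tendsto_compose[of UNIV g]) auto
        then show "(\<lambda>n. std_normal_density x * g (t + (- \<epsilon> n / (2 * pi)) * x)) \<longlonglongrightarrow> std_normal_density x * g t"
          by (intro tendsto_intros)
      qed
      show "AE x in lborel. norm (std_normal_density x * g (t + (- \<epsilon> n / (2 * pi)) * x)) \<le> std_normal_density x * (L * (2 * r + 1))" for n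
        using lip_bump_bound[OF g r] lip_bumpD(2)[OF g]
        by (auto simp: abs_mult intro!: mult_left_mono)
      show "integrable lborel (\<lambda>x. std_normal_density x * (L * (2 * r + 1)))" by auto
    qed measurable
    ultimately show ?thesis using e by (simp add: tendsto_of_real_iff)
  qed
  ultimately show ?thesis by (rule LIMSEQ_unique[rotated])
qed

section \<open>Log-convex sequences and Bang's theorem\<close>

definition log_convex :: "(nat \<Rightarrow> real) \<Rightarrow> bool" where
  "log_convex M \<longleftrightarrow> (\<forall>m. 0 < M m) \<and> (\<forall>m. M (Suc m) ^ 2 \<le> M m * M (Suc (Suc m)))"

lemma log_convex_pos: "log_convex M \<Longrightarrow> 0 < M m"
  by (simp add: log_convex_def)

lemma log_convex_ratio:
  assumes M: "log_convex M" and "i \<le> n"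
  shows "M (Suc i) / M i \<le> M (Suc n) / M n"
  using assms(2)
proof (induction n rule: dec_induct)
  case (step n)
  have "M (Suc n) / M n \<le> M (Suc (Suc n)) / M (Suc n)"
    using M by (simp add: log_convex_def divide_simps power2_eq_square mult_ac)
  with step show ?case by simp
qed simp

lemma log_convex_growth:
  assumes M: "log_convex M" and "j + i \<le> Suc N"
  shows "M (j + i) \<le> M j * (M (Suc N) / M N) ^ i"
  using assms(2)
proof (induction i)
  case (Suc i)
  note p = log_convex_pos[OF M]
  have "M (j + Suc i) = M (Suc (j + i)) / M (j + i) * M (j + i)"
    using p[of "j + i"] by simp
  also have "\<dots> \<le> (M (Suc N) / M N) * (M j * (M (Suc N) / M N) ^ i)"
    using Suc p by (intro mult_mono log_convex_ratio[OF M]) (auto intro: less_imp_le divide_nonneg_nonneg)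
  finally show ?case by (simp add: mult_ac)
qed simp

lemma log_convex_decay:
  assumes M: "log_convex M"
  shows "M n \<le> (M n / M (Suc n)) ^ m * M (n + m)"
proof (induction m)
  case (Suc m)
  note p = log_convex_pos[OF M]
  have "M (Suc n) / M n \<le> M (Suc (n + m)) / M (n + m)"
    by (rule log_convex_ratio[OF M]) simp
  then have "M (n + m) / M (Suc (n + m)) \<le> M n / M (Suc n)"
    using p by (simp add: divide_simps mult_ac)
  then have "M (n + m) \<le> M n / M (Suc n) * M (Suc (n + m))"
    using p[of "Suc (n + m)"] by (simp add: pos_divide_le_eq)
  then have "(M n / M (Suc n)) ^ m * M (n + m) \<le> (M n / M (Suc n)) ^ m * (M n / M (Suc n) * M (Suc (n + m)))"
    using p by (intro mult_left_mono) (auto intro!: zero_le_power divide_nonneg_nonneg less_imp_le)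
  with Suc show ?case by (simp add: mult_ac)
qed simp

lemma sum_exp_le:
  fixes x :: real
  assumes "x \<ge> 0"
  shows "(\<Sum>i<n. x ^ i / fact i) \<le> exp x"
  using sum_le_suminf[OF summable_exp[of x], of "{..<n}"] assms
  by (simp add: exp_def field_simps)

text \<open>
  Taylor's formula of order \<open>Suc N - j\<close> for the \<open>j\<close>-th derivative.
  Log-convexity bounds every \<open>M (j + i)\<close> by \<open>M j * q ^ i\<close> with the single
  ratio \<open>q = M (Suc N) / M N\<close>, so that the Taylor terms sum up to an exponential
  series: a step of length at most \<open>1 / (e q)\<close> costs one factor \<open>e\<close>, that
  is, one level of smallness. The functions \<open>h j\<close> stand for the successive derivatives,
  and Taylor's inequality is the relation between them in the form in which it is verified for
  Fourier integrals.
\<close>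

lemma bang_step:
  fixes h :: "nat \<Rightarrow> real \<Rightarrow> complex"
  assumes M: "log_convex M"
    and taylor: "\<And>j n. norm (h j (t + s) - (\<Sum>i<n. h (j + i) t * of_real (s ^ i / fact i))) \<le> M (j + n) * \<bar>s\<bar> ^ n / fact n"
    and P: "\<And>j. j < Suc N \<Longrightarrow> norm (h j t) \<le> exp (real j - real (Suc N)) * M j"
    and s: "0 \<le> s" "s \<le> M N / (exp 1 * M (Suc N))" and j: "j < N"
  shows "norm (h j (t + s)) \<le> exp (real j - real N) * M j"
proof -
  note p = log_convex_pos[OF M]
  define q where "q = M (Suc N) / M N"
  define n where "n = Suc N - j"
  define c where "c = exp (real j - real (Suc N)) * M j"
  have q: "q > 0" using p by (simp add: q_def)
  have c: "c > 0" using p by (simp add: c_def)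
  have n: "j + n = Suc N" "n > 0" using j by (auto simp: n_def)
  define x where "x = exp 1 * q * s"
  have x: "x \<ge> 0" "x \<le> 1"
    using q s p[of N] p[of "Suc N"] by (auto simp: x_def q_def field_simps)
  have "norm (h j (t + s)) \<le> norm (\<Sum>i<n. h (j + i) t * of_real (s ^ i / fact i)) + M (j + n) * \<bar>s\<bar> ^ n / fact n"
    using taylor[of j n] norm_triangle_sub[of "h j (t + s)" "\<Sum>i<n. h (j + i) t * of_real (s ^ i / fact i)"] by linarith
  also have "norm (\<Sum>i<n. h (j + i) t * of_real (s ^ i / fact i)) \<le> (\<Sum>i<n. c * (x ^ i / fact i))"
  proof (rule sum_norm_le)
    fix i assume "i \<in> {..<n}"
    then have i: "j + i < Suc N" using n by auto
    have "norm (h (j + i) t) \<le> exp (real (j + i) - real (Suc N)) * M (j + i)"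
      by (rule P[OF i])
    also have "\<dots> \<le> exp (real (j + i) - real (Suc N)) * (M j * q ^ i)"
      unfolding q_def using i by (intro mult_left_mono log_convex_growth[OF M]) auto
    also have "\<dots> = c * (exp 1 * q) ^ i"
    proof -
      have "exp (real (j + i) - real (Suc N)) = exp (real j - real (Suc N)) * exp (real i * 1)"
        unfolding exp_add[symmetric] by simp
      also have "exp (real i * 1) = exp (1::real) ^ i" by (rule exp_of_nat_mult)
      finally show ?thesis by (simp add: c_def power_mult_distrib mult_ac)
    qed
    finally have "norm (h (j + i) t) * (s ^ i / fact i) \<le> c * (exp 1 * q) ^ i * (s ^ i / fact i)"
      using s by (intro mult_right_mono) auto
    then show "norm (h (j + i) t * of_real (s ^ i / fact i)) \<le> c * (x ^ i / fact i)"
      using s by (simp add: norm_mult norm_divide norm_power x_def power_mult_distrib mult_ac)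
  qed
  also have "M (j + n) * \<bar>s\<bar> ^ n / fact n \<le> c * (x ^ n / fact n)"
  proof -
    have "M (j + n) \<le> M j * q ^ n"
      unfolding q_def using n by (intro log_convex_growth[OF M]) auto
    also have "M j * q ^ n = c * (exp 1 * q) ^ n"
    proof -
      have n': "real n = real (Suc N) - real j" using n(1) by linarith
      have "exp (real j - real (Suc N)) * exp (1::real) ^ n = exp (real j - real (Suc N)) * exp (real n * 1)"
        using exp_of_nat_mult[of n "1::real"] by simp
      also have "\<dots> = 1"
        unfolding exp_add[symmetric] n' by simp
      finally show ?thesis by (simp add: c_def power_mult_distrib mult_ac)
    qed
    finally have "M (j + n) * (\<bar>s\<bar> ^ n / fact n) \<le> c * (exp 1 * q) ^ n * (\<bar>s\<bar> ^ n / fact n)"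
      by (intro mult_right_mono) auto
    then show ?thesis using s by (simp add: x_def power_mult_distrib mult_ac)
  qed
  also have "(\<Sum>i<n. c * (x ^ i / fact i)) + c * (x ^ n / fact n) = c * (\<Sum>i<Suc n. x ^ i / fact i)"
    by (simp add: sum_distrib_left distrib_left)
  also have "\<dots> \<le> c * exp 1"
    using c x by (intro mult_left_mono order.trans[OF sum_exp_le[OF x(1)]]) auto
  also have "\<dots> = exp (real j - real N) * M j"
    by (simp add: c_def exp_diff exp_add)
  finally show ?thesis by simp
qed

text \<open>
  Descending from level \<open>k + m\<close> to level \<open>k\<close>, the allowed step lengths add
  up.
\<close>

lemma bang_chain:
  fixes h :: "nat \<Rightarrow> real \<Rightarrow> complex"
  assumes M: "log_convex M"
    and taylor: "\<And>j n t s. norm (h j (t + s) - (\<Sum>i<n. h (j + i) t * of_real (s ^ i / fact i))) \<le> M (j + n) * \<bar>s\<bar> ^ n / fact n"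
    and "\<And>j. j < k + m \<Longrightarrow> norm (h j t) \<le> exp (real j - real (k + m)) * M j"
    and "0 \<le> s" "s \<le> (\<Sum>i<m. M (k + i) / (exp 1 * M (Suc (k + i))))" and "j < k"
  shows "norm (h j (t + s)) \<le> exp (real j - real k) * M j"
  using assms(3-)
proof (induction m arbitrary: t s j)
  case (Suc m)
  define d where "d = M (k + m) / (exp 1 * M (Suc (k + m)))"
  define u where "u = min s d"
  have "d \<ge> 0" using log_convex_pos[OF M] by (auto simp: d_def intro!: divide_nonneg_nonneg mult_nonneg_nonneg less_imp_le)
  have "norm (h j (t + u + (s - u))) \<le> exp (real j - real k) * M j"
  proof (rule Suc.IH)
    show "norm (h j (t + u)) \<le> exp (real j - real (k + m)) * M j" if "j < k + m" for j
      by (rule bang_step[where h = h and M = M and t = t and s = u and N = "k + m", OF M taylor]) (use Suc.prems \<open>d \<ge> 0\<close> that in \<open>auto simp: u_def d_def\<close>)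
    have "0 \<le> (\<Sum>i<m. M (k + i) / (exp 1 * M (Suc (k + i))))"
      using log_convex_pos[OF M] by (intro sum_nonneg divide_nonneg_nonneg mult_nonneg_nonneg less_imp_le[OF log_convex_pos[OF M]]) auto
    then show "s - u \<le> (\<Sum>i<m. M (k + i) / (exp 1 * M (Suc (k + i))))"
      using Suc.prems by (auto simp: u_def d_def min_def)
  qed (use Suc.prems in \<open>auto simp: u_def\<close>)
  then show ?case by simp
qed auto

text \<open>
  At a common zero of all derivatives every level of smallness is attained. As the step lengths have
  a divergent sum, a point at a fixed distance is reached within the levels above \<open>k\<close>,
  for every \<open>k\<close>, and the value there is at most \<open>exp (- k) * M 0\<close>.
\<close>

theorem bang_quasianalytic:
  fixes h :: "nat \<Rightarrow> real \<Rightarrow> complex"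
  assumes M: "log_convex M" and div: "\<not> summable (\<lambda>i. M i / M (Suc i))"
    and taylor: "\<And>j n t s. norm (h j (t + s) - (\<Sum>i<n. h (j + i) t * of_real (s ^ i / fact i))) \<le> M (j + n) * \<bar>s\<bar> ^ n / fact n"
    and zero: "\<And>j. h j t = 0" and s: "0 \<le> s"
  shows "h 0 (t + s) = 0"
proof -
  note p = log_convex_pos[OF M]
  have bound: "norm (h 0 (t + s)) \<le> exp (- real (Suc k)) * M 0" for k
  proof -
    let ?d = "\<lambda>i. M (Suc k + i) / (exp 1 * M (Suc (Suc k + i)))"
    have d0: "?d i \<ge> 0" for i
      using p by (intro divide_nonneg_nonneg mult_nonneg_nonneg less_imp_le[OF p]) auto
    have "\<exists>m. s \<le> sum ?d {..<m}"
    proof (rule ccontr)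
      assume "\<not> ?thesis"
      then have "summable ?d"
        by (intro summableI_nonneg_bounded[of ?d s] d0) (auto simp: not_le intro: less_imp_le)
      then have "summable (\<lambda>i. exp 1 * ?d i)" by (rule summable_mult)
      then have "summable (\<lambda>i. M (i + Suc k) / M (Suc (i + Suc k)))"
        by (simp add: field_simps)
      with div show False
        using summable_iff_shift[of "\<lambda>i. M i / M (Suc i)" "Suc k"] by simp
    qed
    then obtain m where m: "s \<le> sum ?d {..<m}" by blast
    have "norm (h 0 (t + s)) \<le> exp (real 0 - real (Suc k)) * M 0"
      by (rule bang_chain[where h = h and M = M and t = t and s = s and k = "Suc k" and m = m and j = 0, OF M taylor _ s m]) (use p in \<open>auto simp: zero less_imp_le\<close>)
    then show ?thesis by simp
  qed
  have "(\<lambda>k. exp (- real k) * M 0) \<longlonglongrightarrow> 0 * M 0"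
    by (intro tendsto_intros filterlim_compose[OF exp_at_bot]
        filterlim_compose[OF filterlim_uminus_at_bot_at_top] filterlim_real_sequentially)
  from LIMSEQ_le_const[OF LIMSEQ_Suc[OF this], of "norm (h 0 (t + s))"] bound
  show ?thesis by auto
qed

section \<open>A dyadic form of Carleman's inequality\<close>

text \<open>
  Let \<open>a i = M i / M (Suc i)\<close>, which is decreasing, and let \<open>G k\<close> be the
  geometric mean of the first \<open>2 ^ k\<close> of these numbers. The next \<open>2 ^ k\<close>
  of them are at most \<open>a (2 ^ k)\<close>, hence \<open>G (Suc k)\<close> is at most the
  geometric mean of \<open>G k\<close> and \<open>a (2 ^ k)\<close>. After multiplication by powers
  of two, the weighted inequality between the means gives a recursion with contraction factor
  \<open>1/2\<close> and a summable inhomogeneity.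
\<close>

lemma carleman_dyadic:
  assumes M: "log_convex M" and sum: "summable (\<lambda>i. M i / M (Suc i))"
  shows "summable (\<lambda>k. 2 ^ k * (M 0 / M (2 ^ k)) powr (1 / 2 ^ k))"
proof -
  note p = log_convex_pos[OF M]
  define a where "a i = M i / M (Suc i)" for i
  have a: "a i > 0" for i using p by (simp add: a_def)
  have "M (Suc m) / M m \<le> M (Suc (Suc m)) / M (Suc m)" for m
    by (rule log_convex_ratio[OF M]) simp
  then have "a (Suc m) \<le> a m" for m
    using le_imp_inverse_le[of "M (Suc m) / M m" "M (Suc (Suc m)) / M (Suc m)"] p by (simp add: a_def)
  then have b: "summable (\<lambda>k. 2 ^ k * a (2 ^ k))"
    using sum a by (subst condensation_test[symmetric]) (auto simp: a_def[abs_def] less_imp_le)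
  define G where "G k = (M 0 / M (2 ^ k)) powr (1 / 2 ^ k)" for k
  have G: "G k > 0" for k using p by (simp add: G_def less_imp_neq[THEN not_sym])
  have step: "2 ^ Suc k * G (Suc k) \<le> (2 ^ k * G k) / 2 + 2 * (2 ^ k * a (2 ^ k))" for k
  proof -
    have "M (2 ^ k) \<le> a (2 ^ k) ^ 2 ^ k * M (2 ^ Suc k)"
      using log_convex_decay[OF M, of "2 ^ k" "2 ^ k"] by (simp add: a_def mult_2)
    then have "M 0 / M (2 ^ Suc k) \<le> M 0 / M (2 ^ k) * a (2 ^ k) ^ 2 ^ k"
      using p[of 0] p[of "2 ^ k"] p[of "2 ^ Suc k"] by (simp add: divide_simps mult_ac)
    then have "G (Suc k) \<le> (M 0 / M (2 ^ k) * a (2 ^ k) ^ 2 ^ k) powr (1 / 2 ^ Suc k)"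
      unfolding G_def using p by (intro powr_mono2) (auto intro: less_imp_le)
    also have "\<dots> = (M 0 / M (2 ^ k)) powr (1 / 2 ^ Suc k) * (a (2 ^ k) ^ 2 ^ k) powr (1 / 2 ^ Suc k)"
      by (rule powr_mult)
    also have "(a (2 ^ k) ^ 2 ^ k) powr (1 / 2 ^ Suc k) = (a (2 ^ k) powr real (2 ^ k)) powr (1 / 2 ^ Suc k)"
      using a[of "2 ^ k"] by (simp only: powr_realpow)
    also have "\<dots> = sqrt (a (2 ^ k))"
      using a[of "2 ^ k"] by (simp add: powr_powr powr_half_sqrt)
    also have "(M 0 / M (2 ^ k)) powr (1 / 2 ^ Suc k) = ((M 0 / M (2 ^ k)) powr (1 / 2 ^ k)) powr (1 / 2)"
    proof -
      have e: "1 / 2 ^ Suc k = 1 / 2 ^ k * (1 / 2 :: real)" by simp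
      show ?thesis unfolding e by (rule powr_powr[symmetric])
    qed
    also have "\<dots> = sqrt (G k)"
      using G[of k] by (simp add: G_def powr_half_sqrt)
    finally have "2 ^ Suc k * G (Suc k) \<le> 2 * (2 ^ k * (sqrt (G k) * sqrt (a (2 ^ k))))"
      by (simp add: mult_left_mono)
    also have "2 * (sqrt (G k) * sqrt (a (2 ^ k))) \<le> G k / 2 + 2 * a (2 ^ k)"
    proof -
      have "0 \<le> (sqrt (G k) - 2 * sqrt (a (2 ^ k)))\<^sup>2" by simp
      then show ?thesis using less_imp_le[OF G[of k]] less_imp_le[OF a[of "2 ^ k"]]
        by (simp add: power2_diff power_mult_distrib)
    qed
    then have "2 * (2 ^ k * (sqrt (G k) * sqrt (a (2 ^ k)))) \<le> 2 ^ k * (G k / 2 + 2 * a (2 ^ k))"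
      using mult_left_mono[of "2 * (sqrt (G k) * sqrt (a (2 ^ k)))" "G k / 2 + 2 * a (2 ^ k)" "2 ^ k"] by (simp add: mult_ac)
    finally show ?thesis by (simp add: algebra_simps)
  qed
  define g where "g k = 2 ^ k * G k" for k
  have g: "g k \<ge> 0" for k using G[of k] by (simp add: g_def)
  define B where "B = (\<Sum>k. 2 ^ k * a (2 ^ k))"
  have "(\<Sum>k<n. g k) \<le> 2 * g 0 + 4 * B" for n
  proof -
    have "(\<Sum>k<n. g (Suc k)) \<le> (\<Sum>k<n. g k / 2 + 2 * (2 ^ k * a (2 ^ k)))"
      using step by (intro sum_mono) (simp add: g_def)
    also have "\<dots> = (\<Sum>k<n. g k) / 2 + 2 * (\<Sum>k<n. 2 ^ k * a (2 ^ k))"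
      by (simp add: sum.distrib sum_distrib_left sum_divide_distrib)
    also have "(\<Sum>k<n. 2 ^ k * a (2 ^ k)) \<le> B"
      unfolding B_def using b a by (intro sum_le_suminf) (auto intro: less_imp_le)
    finally have "(\<Sum>k<n. g (Suc k)) \<le> (\<Sum>k<n. g k) / 2 + 2 * B" by simp
    moreover have "(\<Sum>k<n. g k) \<le> (\<Sum>k<Suc n. g k)" using g by simp
    moreover have "(\<Sum>k<Suc n. g k) = g 0 + (\<Sum>k<n. g (Suc k))" by (rule sum.lessThan_Suc_shift)
    ultimately show ?thesis by linarith
  qed
  then have "summable g" using g by (intro summableI_nonneg_bounded)
  then show ?thesis by (simp add: g_def[abs_def] G_def)
qed

text \<open>
  For a decreasing function, the sums over powers of \<open>2\<close> and over powers of
  \<open>16\<close> differ by at most the factor \<open>4\<close>.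
\<close>

lemma summable_pow2_of_pow16:
  fixes \<phi> :: "real \<Rightarrow> real"
  assumes anti: "antimono_on {0..} \<phi>" and nonneg: "\<And>r. r \<ge> 0 \<Longrightarrow> \<phi> r \<ge> 0"
    and "summable (\<lambda>k. \<phi> ((2 ^ k) ^ 4))"
  shows "summable (\<lambda>k. \<phi> (2 ^ k))"
proof (rule summableI_nonneg_bounded)
  have anti\<phi>: "\<phi> s \<le> \<phi> r" if "0 \<le> r" "r \<le> s" for r s
    using anti that by (auto simp: monotone_on_def)
  show nn: "0 \<le> \<phi> (2 ^ k)" for k by (rule nonneg) simp
  fix n
  have "(\<Sum>k<n. \<phi> (2 ^ k)) \<le> (\<Sum>k<n*4. \<phi> (2 ^ k))"
    by (rule sum_mono2) (auto intro: nn)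
  also have "\<dots> = (\<Sum>m<n. \<Sum>k=m*4..<m*4+4. \<phi> (2 ^ k))"
    by (rule sum.nat_group[symmetric])
  also have "\<dots> \<le> (\<Sum>m<n. \<Sum>k=m*4..<m*4+4. \<phi> ((2 ^ m) ^ 4))"
    by (intro sum_mono anti\<phi>) (auto simp flip: power_mult intro!: power_increasing)
  also have "\<dots> = 4 * (\<Sum>m<n. \<phi> ((2 ^ m) ^ 4))"
    by (simp add: sum_distrib_left)
  also have "\<dots> \<le> 4 * (\<Sum>m. \<phi> ((2 ^ m) ^ 4))"
    using assms(3) by (intro mult_left_mono sum_le_suminf) (auto intro: nonneg)
  finally show "(\<Sum>k<n. \<phi> (2 ^ k)) \<le> 4 * (\<Sum>m. \<phi> ((2 ^ m) ^ 4))" .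
qed

lemma divergent_of_growth:
  fixes \<phi> :: "real \<Rightarrow> real"
  assumes M: "log_convex M"
    and anti: "antimono_on {0..} \<phi>" and pos: "\<And>r. r \<ge> 0 \<Longrightarrow> \<phi> r > 0"
    and div: "\<not> summable (\<lambda>k. \<phi> (2 ^ k))"
    and A: "A > 0" and K: "K > 0"
    and growth: "\<And>m. m \<ge> 1 \<Longrightarrow> M m \<le> A * (K * real m / \<phi> (real m ^ 4)) ^ m"
  shows "\<not> summable (\<lambda>i. M i / M (Suc i))"
proof
  assume "summable (\<lambda>i. M i / M (Suc i))"
  then have S: "summable (\<lambda>k. 2 ^ k * (M 0 / M (2 ^ k)) powr (1 / 2 ^ k))"
    by (rule carleman_dyadic[OF M])
  note p = log_convex_pos[OF M]
  \<comment> \<open>The constants \<open>M 0\<close> and \<open>A\<close> disappear under the \<open>m\<close>-th root, since \<open>c ^ m \<le> M 0 / A\<close>.\<close>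
  define c where "c = min 1 (M 0 / A)"
  have c: "0 < c" "c \<le> 1" using p[of 0] A by (auto simp: c_def)
  have "summable (\<lambda>k. \<phi> ((2 ^ k) ^ 4))"
  proof (rule summable_comparison_test'[OF summable_mult[OF S, of "K / c"]])
    fix k :: nat
    define m :: nat where "m = 2 ^ k"
    have m: "m \<ge> 1" by (simp add: m_def)
    define x where "x = \<phi> (real m ^ 4) / (K * real m)"
    have x: "x > 0" using pos m K by (auto simp: x_def)
    have "M m * x ^ m \<le> A * (K * real m / \<phi> (real m ^ 4)) ^ m * x ^ m"
      using growth[OF m] x by (intro mult_right_mono) auto
    also have "\<dots> = A"
      using pos[of "real m ^ 4"] m K by (simp add: x_def power_mult_distrib[symmetric] mult.assoc)
    finally have "M 0 / A * x ^ m \<le> M 0 / M m"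
      using p[of 0] p[of m] A by (simp add: divide_simps mult_ac)
    moreover have "c * x ^ m \<le> M 0 / A * x ^ m"
      using x by (intro mult_right_mono) (auto simp: c_def)
    moreover have "c ^ m * x ^ m \<le> c * x ^ m"
      using c x m by (intro mult_right_mono power_le_one_iff[THEN iffD2] order.trans[OF power_decreasing[of 1 m c]]) auto
    ultimately have "(c * x) ^ m \<le> M 0 / M m" by (simp add: power_mult_distrib)
    then have "((c * x) ^ m) powr (1 / real m) \<le> (M 0 / M m) powr (1 / real m)"
      using c x by (intro powr_mono2) auto
    also have "((c * x) ^ m) powr (1 / real m) = c * x"
      using c x m by (simp add: powr_realpow[symmetric] powr_powr)
    finally have "c * x \<le> (M 0 / M m) powr (1 / real m)" .
    then have "K / c * (real m * (c * x)) \<le> K / c * (real m * (M 0 / M m) powr (1 / real m))"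
      using K c by (intro mult_left_mono) auto
    moreover have "K / c * (real m * (c * x)) = \<phi> (real m ^ 4)"
      using K c m by (simp add: x_def)
    ultimately show "norm (\<phi> ((2 ^ k) ^ 4)) \<le> K / c * (2 ^ k * (M 0 / M (2 ^ k)) powr (1 / 2 ^ k))"
      using pos[of "(2 ^ k) ^ 4"] by (simp add: m_def)
  qed
  then show False
    using summable_pow2_of_pow16[OF anti less_imp_le[OF pos]] div by blast
qed

section \<open>Products over the coordinates\<close>

lemma vec_nth_borel [measurable]: "(\<lambda>x::real^'n. x $ i) \<in> borel_measurable borel"
  by (intro borel_measurable_continuous_onI continuous_intros)

lemma bij_betw_axis: "bij_betw (\<lambda>i. axis i (1::real)) UNIV (Basis :: (real^'n) set)"
  by (auto simp: bij_betw_def Basis_vec_def inj_on_def axis_eq_axis)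

lemma lborel_vec_eq:
  "(lborel :: (real^'n) measure) =
     distr (\<Pi>\<^sub>M b\<in>(Basis :: (real^'n) set). lborel) borel (\<lambda>f. \<Sum>b\<in>Basis. f b *\<^sub>R b)"
  unfolding lborel_eq_real by (rule lborel_def)

text \<open>
  Lebesgue measure on \<open>real ^ 'n\<close> is the image of a product measure indexed by the
  basis vectors; the work is the reindexing from coordinates to basis vectors.
\<close>

lemma
  fixes f :: "'n::finite \<Rightarrow> real \<Rightarrow> complex"
  assumes f: "\<And>i. integrable lborel (f i)"
  shows integrable_vec_prod: "integrable lborel (\<lambda>x::real^'n. \<Prod>i\<in>UNIV. f i (x $ i))"
    and integral_vec_prod: "(LINT x|lborel. (\<Prod>i\<in>UNIV. f i ((x::real^'n) $ i))) = (\<Prod>i\<in>UNIV. LINT t|lborel. f i t)"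
proof -
  interpret product_sigma_finite "\<lambda>b::real^'n. lborel :: real measure"
    by (intro product_sigma_finite.intro sigma_finite_lborel)
  let ?ax = "\<lambda>i::'n. axis i (1::real)"
  let ?P = "\<Pi>\<^sub>M b\<in>(Basis :: (real^'n) set). (lborel :: real measure)"
  let ?T = "\<lambda>g. \<Sum>b\<in>(Basis :: (real^'n) set). g b *\<^sub>R b"
  define F where "F b = f (the_inv_into UNIV ?ax b)" for b
  have Fax: "F (?ax i) = f i" for i
    unfolding F_def by (subst the_inv_into_f_f) (auto simp: inj_on_def axis_eq_axis)
  have T: "?T g $ i = g (?ax i)" for g i
  proof -
    have "?T g $ i = (\<Sum>b\<in>Basis. g b * (b $ i))" by simp
    also have "\<dots> = (\<Sum>j\<in>UNIV. g (?ax j) * (?ax j $ i))"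
      by (rule sum.reindex_bij_betw[OF bij_betw_axis, symmetric])
    also have "\<dots> = g (?ax i)" by (simp add: axis_def if_distrib cong: if_cong)
    finally show ?thesis .
  qed
  have prodT: "(\<Prod>i\<in>UNIV. f i (?T g $ i)) = (\<Prod>b\<in>Basis. F b (g b))" for g
    unfolding T using prod.reindex_bij_betw[OF bij_betw_axis, of "\<lambda>b. F b (g b)"] by (simp add: Fax)
  have Tm: "?T \<in> measurable ?P borel" by measurable
  have fm [measurable]: "f i \<in> borel_measurable borel" for i using f[of i] by auto
  have m: "(\<lambda>x::real^'n. \<Prod>i\<in>UNIV. f i (x $ i)) \<in> borel_measurable borel" by measurable
  have F: "integrable lborel (F b)" for b unfolding F_def by (rule f)
  have "integrable ?P (\<lambda>g. \<Prod>b\<in>Basis. F b (g b))"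
    by (rule product_integrable_prod) (use F in auto)
  then show "integrable lborel (\<lambda>x::real^'n. \<Prod>i\<in>UNIV. f i (x $ i))"
    unfolding lborel_vec_eq by (subst integrable_distr_eq[OF Tm m]) (simp only: prodT)
  have "(LINT x|lborel. (\<Prod>i\<in>UNIV. f i ((x::real^'n) $ i))) = (LINT g|?P. (\<Prod>b\<in>Basis. F b (g b)))"
    unfolding lborel_vec_eq by (subst integral_distr[OF Tm m]) (simp only: prodT)
  also have "\<dots> = (\<Prod>b\<in>Basis. LINT t|lborel. F b t)"
    by (rule product_integral_prod) (use F in auto)
  also have "\<dots> = (\<Prod>i\<in>UNIV. LINT t|lborel. f i t)"
    using prod.reindex_bij_betw[OF bij_betw_axis, of "\<lambda>b. LINT t|lborel. F b t"] by (simp add: Fax)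
  finally show "(LINT x|lborel. (\<Prod>i\<in>UNIV. f i ((x::real^'n) $ i))) = (\<Prod>i\<in>UNIV. LINT t|lborel. f i t)" .
qed

lemma cis_sum: "finite A \<Longrightarrow> cis (\<Sum>i\<in>A. f i) = (\<Prod>i\<in>A. cis (f i))"
  by (induction A rule: finite_induct) (simp_all flip: cis_mult)

lemma inner_borel: "(\<lambda>x. x \<bullet> y) \<in> borel_measurable borel" for y :: "real^'n"
  by (intro borel_measurable_continuous_onI continuous_intros)

lemma fourier_transform_cis:
  "fourier_transform f y = (LINT x|lebesgue. f x * cis (- (2 * pi * (x \<bullet> y))))"
  unfolding fourier_transform_def cis_conv_exp by (simp add: mult_ac)

definition tensor :: "(real \<Rightarrow> 'a::comm_monoid_mult) \<Rightarrow> real ^ 'n \<Rightarrow> 'a" where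
  "tensor g x = (\<Prod>i\<in>UNIV. g (x $ i))"

lemma fourier_transform_tensor:
  assumes g: "lip_bump L r g"
  shows "fourier_transform (\<lambda>x::real^'n. of_real (tensor g x)) y = tensor (fourier1 g) y"
proof -
  note [measurable] = lip_bumpD(4)[OF g]
  let ?f = "\<lambda>i t. of_real (g t) * cis (- (2 * pi * (y $ i) * t))"
  have int: "integrable lborel (?f i)" for i
    by (rule Bochner_Integration.integrable_bound[OF lip_bump_integrable[OF g]]) (auto simp: norm_mult)
  have "fourier_transform (\<lambda>x::real^'n. of_real (tensor g x)) y =
      (LINT x|lborel. of_real (tensor g x) * cis (- (2 * pi * (x \<bullet> y))))"
    unfolding fourier_transform_cis tensor_def by (rule integral_completion) measurable
  also have "\<dots> = (LINT x|lborel. (\<Prod>i\<in>UNIV. ?f i ((x::real^'n) $ i)))"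
    by (intro Bochner_Integration.integral_cong refl)
       (simp add: tensor_def prod.distrib inner_vec_def cis_sum[symmetric] sum_distrib_left sum_negf[symmetric] mult_ac)
  also have "\<dots> = tensor (fourier1 g) y"
    unfolding integral_vec_prod[OF int] by (simp add: tensor_def fourier1_def)
  finally show ?thesis .
qed

text \<open>
  Only the factor of the largest coordinate is used. That coordinate lies between \<open>norm y /
  n\<close> and \<open>norm y\<close>: the lower bound costs the factor \<open>n\<close> in the
  exponent of the hypothesis, and by the upper bound the decreasing function \<open>\<phi>\<close>
  is evaluated in the favourable direction.
\<close>

lemma tensor_fourier1_decay:
  fixes y :: "real^'n"
  assumes g: "lip_bump L r g" "(LINT t|lborel. g t) = 1"
    and decay: "\<And>s. norm (fourier1 g s) \<le> C * exp (- (real CARD('n) * \<phi> \<bar>s\<bar>) * \<bar>s\<bar>)"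
    and C: "C \<ge> 0"
    and anti: "antimono_on {0..} \<phi>" and nonneg: "\<And>r. r \<ge> 0 \<Longrightarrow> \<phi> r \<ge> 0"
  shows "norm (tensor (fourier1 g) y) \<le> C * exp (- \<phi> (norm y) * norm y)"
proof -
  let ?m = "Max (range (\<lambda>i. \<bar>y $ i\<bar>))"
  have "?m \<in> range (\<lambda>i. \<bar>y $ i\<bar>)" by (rule Max_in) auto
  then obtain i where i: "?m = \<bar>y $ i\<bar>" by (elim imageE)
  have le: "\<bar>y $ j\<bar> \<le> \<bar>y $ i\<bar>" for j
    unfolding i[symmetric] by (rule Max_ge) auto
  have "norm y \<le> (\<Sum>j\<in>UNIV. \<bar>y $ j\<bar>)" by (rule norm_le_l1_cart)
  also have "\<dots> \<le> (\<Sum>j\<in>(UNIV::'n set). \<bar>y $ i\<bar>)" by (intro sum_mono le)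
  finally have y1: "norm y \<le> real CARD('n) * \<bar>y $ i\<bar>" by simp
  have y2: "\<bar>y $ i\<bar> \<le> norm y" by (rule component_le_norm_cart)
  have "norm (tensor (fourier1 g) y) = norm (fourier1 g (y $ i)) * (\<Prod>j\<in>UNIV - {i}. norm (fourier1 g (y $ j)))"
    unfolding tensor_def prod_norm[symmetric] by (subst prod.remove[of _ i]) auto
  also have "\<dots> \<le> norm (fourier1 g (y $ i)) * 1"
    using norm_fourier1_le[OF g(1)] g(2) by (intro mult_left_mono prod_le_1) auto
  also have "\<dots> \<le> C * exp (- (real CARD('n) * \<phi> \<bar>y $ i\<bar>) * \<bar>y $ i\<bar>)"
    using decay by simp
  also have "\<dots> \<le> C * exp (- \<phi> (norm y) * norm y)"
  proof -
    have "\<phi> (norm y) * norm y \<le> \<phi> (norm y) * (real CARD('n) * \<bar>y $ i\<bar>)"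
      using y1 nonneg by (intro mult_left_mono) auto
    also have "\<dots> \<le> \<phi> \<bar>y $ i\<bar> * (real CARD('n) * \<bar>y $ i\<bar>)"
      using anti y2 by (intro mult_right_mono) (auto simp: monotone_on_def)
    finally show ?thesis using C by (intro mult_left_mono) (auto simp: mult_ac)
  qed
  finally show ?thesis .
qed

section \<open>Compactly supported functions with prescribed decay\<close>

lemma ingham_construction:
  fixes \<phi> :: "real \<Rightarrow> real"
  assumes anti: "antimono_on {0..} \<phi>" and nonneg: "\<And>r. r \<ge> 0 \<Longrightarrow> \<phi> r \<ge> 0"
    and summ: "summable (\<lambda>k. \<phi> (2 ^ k))"
  shows "\<exists>f \<in> Cc_infinity. f \<noteq> (\<lambda>x::real^'n. 0) \<and> fourier_decay (\<lambda>y. \<phi> (norm y)) f"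
proof -
  let ?\<phi> = "\<lambda>r. real CARD('n) * \<phi> r"
  have "antimono_on {0..} ?\<phi>" using anti by (auto simp: monotone_on_def intro!: mult_left_mono)
  moreover have "?\<phi> r \<ge> 0" if "r \<ge> 0" for r using nonneg[OF that] by simp
  ultimately obtain L g C where g: "lip_bump L 1 g" "(LINT t|lborel. g t) = 1" "\<And>k. Ck k g" "C \<ge> 1"
    "\<And>s. norm (fourier1 g s) \<le> C * exp (- ?\<phi> \<bar>s\<bar> * \<bar>s\<bar>)"
    using fast_decaying_kernel[of ?\<phi> 1] summ by auto
  let ?f = "\<lambda>x::real^'n. complex_of_real (tensor g x)"
  have ft: "fourier_transform ?f y = tensor (fourier1 g) y" for y
    by (rule fourier_transform_tensor[OF g(1)])
  show ?thesis
  proof (intro bexI conjI)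
    show "fourier_decay (\<lambda>y. \<phi> (norm y)) ?f"
      unfolding fourier_decay_def ft
      using tensor_fourier1_decay[OF g(1,2,5) _ anti nonneg] g(4) by (auto intro!: exI[of _ C])
    show "?f \<noteq> (\<lambda>x. 0)"
    proof
      assume "?f = (\<lambda>x. 0)"
      then have "fourier_transform ?f 0 = 0" by (simp add: fourier_transform_def)
      moreover have "tensor (fourier1 g) (0::real^'n) = 1"
        using g(2) by (simp add: tensor_def fourier1_def integral_complex_of_real)
      ultimately show False unfolding ft by simp
    qed
    show "?f \<in> Cc_infinity"
      unfolding Cc_infinity_def
    proof (intro CollectI conjI allI)
      fix k
      have "Ck k (\<lambda>x::real^'n. g (x $ i + 0))" for i
        by (rule Ck_affine[OF bounded_linear_vec_nth g(3)])
      then have "Ck k (\<lambda>x::real^'n. tensor g x)"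
        unfolding tensor_def by (intro Ck_prod) simp
      then show "Ck k ?f" by (rule Ck_bounded_linear[OF bounded_linear_of_real])
      have "{x. ?f x \<noteq> 0} \<subseteq> cball 0 (real CARD('n))"
      proof
        fix x :: "real^'n" assume "x \<in> {x. ?f x \<noteq> 0}"
        then have "g (x $ i) \<noteq> 0" for i by (auto simp: tensor_def)
        then have "\<bar>x $ i\<bar> \<le> 1" for i using lip_bumpD(3)[OF g(1)] by (meson not_le)
        then have "(\<Sum>i\<in>UNIV. \<bar>x $ i\<bar>) \<le> (\<Sum>i\<in>(UNIV::'n set). 1)" by (intro sum_mono)
        with norm_le_l1_cart[of x] show "x \<in> cball 0 (real CARD('n))" by simp
      qed
      then have "bounded {x. ?f x \<noteq> 0}" by (rule bounded_subset[OF bounded_cball])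
      then show "compact (closure {x. ?f x \<noteq> 0})" by simp
    qed
  qed
qed

section \<open>The tail integral as a dyadic series\<close>

lemma radial_antimono_borel:
  fixes \<phi> :: "real \<Rightarrow> real"
  assumes anti: "antimono_on {0..} \<phi>"
  shows "(\<lambda>y::real^'n. \<phi> (norm y)) \<in> borel_measurable borel"
proof -
  have "mono (\<lambda>r. - \<phi> (max 0 r))"
    using anti by (auto simp: mono_def monotone_on_def)
  then have "(\<lambda>r. - \<phi> (max 0 r)) \<in> borel_measurable borel" by (rule borel_measurable_mono)
  then have [measurable]: "(\<lambda>r. \<phi> (max 0 r)) \<in> borel_measurable borel" by simp
  have "(\<lambda>y::real^'n. \<phi> (max 0 (norm y))) \<in> borel_measurable borel" by measurable
  then show ?thesis by simp
qed

definition shell :: "nat \<Rightarrow> (real^'n) set" where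
  "shell k = {y. 2 ^ k \<le> norm y \<and> norm y < 2 ^ Suc k}"

lemma shell_borel [measurable]: "shell k \<in> sets borel"
  unfolding shell_def by measurable

lemma disjoint_shells: "disjoint_family (shell :: nat \<Rightarrow> (real^'n) set)"
proof -
  have "shell m \<inter> shell n = ({} :: (real^'n) set)" if "m < n" for m n
  proof -
    have "(2::real) ^ Suc m \<le> 2 ^ n" using that by (intro power_increasing) auto
    then show ?thesis by (auto simp: shell_def)
  qed
  then show ?thesis by (metis disjoint_family_on_def Int_commute linorder_neqE_nat)
qed

lemma Union_shells: "(\<Union>k. shell k) = {y::real^'n. 1 \<le> norm y}"
proof (intro equalityI subsetI)
  fix y :: "real^'n" assume "y \<in> {y. 1 \<le> norm y}"
  then have y: "1 \<le> norm y" by simp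
  define P where "P k \<longleftrightarrow> norm y < 2 ^ k" for k
  have "\<exists>k. P k" unfolding P_def using real_arch_pow[of 2 "norm y"] by auto
  then have L: "P (LEAST k. P k)" by (rule LeastI_ex)
  moreover have "\<not> P 0" using y by (simp add: P_def)
  ultimately obtain m where m: "(LEAST k. P k) = Suc m" by (cases "LEAST k. P k") auto
  then have "\<not> P m" using not_less_Least[of m P] by simp
  then have "y \<in> shell m" using L m by (simp add: shell_def P_def)
  then show "y \<in> (\<Union>k. shell k)" by blast
next
  fix y :: "real^'n" assume "y \<in> (\<Union>k. shell k)"
  then obtain k where "2 ^ k \<le> norm y" by (auto simp: shell_def)
  moreover have "(1::real) \<le> 2 ^ k" by simp
  ultimately show "y \<in> {y. 1 \<le> norm y}" unfolding mem_Collect_eq by linarith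
qed

lemma tail_integral_shells:
  fixes \<phi> :: "real \<Rightarrow> real"
  assumes anti: "antimono_on {0..} \<phi>"
  shows "tail_integral (\<lambda>y::real^'n. \<phi> (norm y)) =
    (\<Sum>k. \<integral>\<^sup>+y\<in>shell k. ennreal (\<phi> (norm (y::real^'n)) / norm y ^ CARD('n)) \<partial>lborel)"
proof -
  note [measurable] = radial_antimono_borel[OF anti]
  show ?thesis
    unfolding tail_integral_def nn_integral_completion Union_shells[symmetric]
    by (rule nn_integral_disjoint_family[OF _ _ disjoint_shells]) auto
qed

text \<open>
  On the shell \<open>2 ^ k \<le> norm y < 2 ^ Suc k\<close> the integrand lies between its extreme
  values, and the volume of the shell is comparable to \<open>2 ^ (k n)\<close>. The contribution of
  the shell is therefore at most a multiple of \<open>\<phi> (2 ^ k)\<close> and at least a multiple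
  of \<open>\<phi> (2 ^ Suc k)\<close>.
\<close>

lemma tail_integral_finite_iff:
  fixes \<phi> :: "real \<Rightarrow> real"
  assumes anti: "antimono_on {0..} \<phi>" and nonneg: "\<And>r. r \<ge> 0 \<Longrightarrow> \<phi> r \<ge> 0"
  shows "tail_integral (\<lambda>y::real^'n. \<phi> (norm y)) < \<infinity> \<longleftrightarrow> summable (\<lambda>k. \<phi> (2 ^ k))"
proof -
  let ?n = "CARD('n)"
  let ?f = "\<lambda>y::real^'n. ennreal (\<phi> (norm y) / norm y ^ ?n)"
  define c where "c = unit_ball_vol (real ?n)"
  have c: "c > 0" unfolding c_def by (rule unit_ball_vol_pos) simp
  have ball: "emeasure lborel (ball (0::real^'n) r) = ennreal (c * r ^ ?n)" if "r \<ge> 0" for r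
    using emeasure_ball[OF that, of "0::real^'n"] by (simp add: c_def)
  have anti\<phi>: "\<phi> s \<le> \<phi> r" if "0 \<le> r" "r \<le> s" for r s
    using anti that by (auto simp: monotone_on_def)
  have shell_eq: "shell k = ball (0::real^'n) (2 ^ Suc k) - ball 0 (2 ^ k)" for k
    by (auto simp: shell_def)
  have upper: "(\<integral>\<^sup>+y\<in>shell k. ?f y \<partial>lborel) \<le> ennreal (c * 2 ^ ?n * \<phi> (2 ^ k))" for k
  proof -
    have "(\<integral>\<^sup>+y\<in>shell k. ?f y \<partial>lborel) \<le> (\<integral>\<^sup>+y. ennreal (\<phi> (2 ^ k) / (2 ^ k) ^ ?n) * indicator (ball (0::real^'n) (2 ^ Suc k)) y \<partial>lborel)"
    proof (rule nn_integral_mono)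
      fix y :: "real^'n"
      show "?f y * indicator (shell k) y \<le> ennreal (\<phi> (2 ^ k) / (2 ^ k) ^ ?n) * indicator (ball (0::real^'n) (2 ^ Suc k)) y"
      proof (cases "y \<in> shell k")
        case True
        then have "\<phi> (norm y) / norm y ^ ?n \<le> \<phi> (2 ^ k) / (2 ^ k) ^ ?n"
          by (intro frac_le nonneg anti\<phi> power_mono) (auto simp: shell_def)
        then show ?thesis using True by (auto simp: shell_eq intro!: ennreal_leI)
      qed simp
    qed
    also have "\<dots> = ennreal (\<phi> (2 ^ k) / (2 ^ k) ^ ?n) * ennreal (c * (2 ^ Suc k) ^ ?n)"
      by (subst nn_integral_cmult_indicator) (auto simp: ball)
    also have "\<dots> = ennreal (\<phi> (2 ^ k) / (2 ^ k) ^ ?n * (c * (2 ^ Suc k) ^ ?n))"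
      using c nonneg by (intro ennreal_mult[symmetric]) auto
    also have "\<phi> (2 ^ k) / (2 ^ k) ^ ?n * (c * (2 ^ Suc k) ^ ?n) = c * 2 ^ ?n * \<phi> (2 ^ k)"
      by (simp add: power_mult_distrib)
    finally show ?thesis .
  qed
  have lower: "ennreal (c / 2 * \<phi> (2 ^ Suc k)) \<le> (\<integral>\<^sup>+y\<in>shell k. ?f y \<partial>lborel)" for k
  proof -
    have "(2 ^ k :: real) ^ ?n \<le> (2 ^ Suc k) ^ ?n / 2"
    proof -
      have "(2::real) ^ 1 \<le> 2 ^ ?n" by (intro power_increasing) (auto simp: Suc_le_eq)
      then show ?thesis by (simp add: power_mult_distrib)
    qed
    then have "c / 2 * (2 ^ Suc k) ^ ?n \<le> c * (2 ^ Suc k) ^ ?n - c * (2 ^ k) ^ ?n"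
      using c mult_left_mono[of "(2 ^ k) ^ ?n" "(2 ^ Suc k) ^ ?n / 2" c] by simp
    then have "ennreal (c / 2 * (2 ^ Suc k) ^ ?n) \<le> ennreal (c * (2 ^ Suc k) ^ ?n - c * (2 ^ k) ^ ?n)"
      by (rule ennreal_leI)
    also have "\<dots> = emeasure lborel (shell k :: (real^'n) set)"
      unfolding shell_eq using c subset_ball[of "2 ^ k" "2 ^ Suc k" "0::real^'n"]
      by (subst emeasure_Diff) (simp_all add: ball ennreal_minus)
    finally have "ennreal (\<phi> (2 ^ Suc k) / (2 ^ Suc k) ^ ?n) * ennreal (c / 2 * (2 ^ Suc k) ^ ?n)
      \<le> ennreal (\<phi> (2 ^ Suc k) / (2 ^ Suc k) ^ ?n) * emeasure lborel (shell k :: (real^'n) set)"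
      by (rule mult_left_mono) simp
    also have "\<dots> = (\<integral>\<^sup>+y\<in>(shell k :: (real^'n) set). ennreal (\<phi> (2 ^ Suc k) / (2 ^ Suc k) ^ ?n) \<partial>lborel)"
      by (subst nn_integral_cmult_indicator) auto
    also have "\<dots> \<le> (\<integral>\<^sup>+y\<in>shell k. ?f y \<partial>lborel)"
    proof (rule nn_integral_mono)
      fix y :: "real^'n"
      show "ennreal (\<phi> (2 ^ Suc k) / (2 ^ Suc k) ^ ?n) * indicator (shell k) y \<le> ?f y * indicator (shell k) y"
      proof (cases "y \<in> shell k")
        case True
        then have y: "2 ^ k \<le> norm y" "norm y < 2 ^ Suc k" by (auto simp: shell_def)
        have "0 < norm y" by (rule less_le_trans[OF _ y(1)]) simp
        then have "\<phi> (2 ^ Suc k) / (2 ^ Suc k) ^ ?n \<le> \<phi> (norm y) / norm y ^ ?n"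
          using y by (intro frac_le nonneg anti\<phi> power_mono) auto
        then show ?thesis using True by (auto intro!: ennreal_leI)
      qed simp
    qed
    finally show ?thesis
      using c nonneg[of "2 ^ Suc k"] by (simp add: ennreal_mult[symmetric] mult.commute)
  qed
  show ?thesis
  proof
    assume "summable (\<lambda>k. \<phi> (2 ^ k))"
    then have "(\<Sum>k. ennreal (c * 2 ^ ?n * \<phi> (2 ^ k))) \<noteq> \<top>"
      using c nonneg by (intro ennreal_suminf_neq_top summable_mult) auto
    moreover have "tail_integral (\<lambda>y::real^'n. \<phi> (norm y)) \<le> (\<Sum>k. ennreal (c * 2 ^ ?n * \<phi> (2 ^ k)))"
      unfolding tail_integral_shells[OF anti] by (intro suminf_le upper) auto
    ultimately show "tail_integral (\<lambda>y::real^'n. \<phi> (norm y)) < \<infinity>"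
      by (simp add: top.not_eq_extremum le_less_trans)
  next
    assume fin: "tail_integral (\<lambda>y::real^'n. \<phi> (norm y)) < \<infinity>"
    have "(\<Sum>k. ennreal (c / 2 * \<phi> (2 ^ Suc k))) \<le> tail_integral (\<lambda>y::real^'n. \<phi> (norm y))"
      unfolding tail_integral_shells[OF anti] by (intro suminf_le lower) auto
    with fin have "(\<Sum>k. ennreal (c / 2 * \<phi> (2 ^ Suc k))) \<noteq> \<top>" by (auto simp: less_top[symmetric] top_unique)
    then have "summable (\<lambda>k. c / 2 * \<phi> (2 ^ Suc k))"
      using c nonneg by (intro summable_suminf_not_top) auto
    then have "summable (\<lambda>k. 2 / c * (c / 2 * \<phi> (2 ^ Suc k)))" by (rule summable_mult)
    then have "summable (\<lambda>k. \<phi> (2 ^ Suc k))" using c by simp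
    then show "summable (\<lambda>k. \<phi> (2 ^ k))" by (subst (asm) summable_Suc_iff)
  qed
qed

section \<open>Convolution with a product kernel\<close>

lemma fourier1_weighted_integrable:
  assumes g: "lip_bump L r g" and int: "integrable lborel (fourier1 g)"
  shows "integrable lborel (\<lambda>t. fourier1 g t * cis (c * t))"
  by (rule Bochner_Integration.integrable_bound[OF int])
     (use fourier1_measurable[OF lip_bumpD(4)[OF g]] in \<open>auto simp: norm_mult\<close>)

lemma tensor_inversion:
  fixes w :: "real^'n"
  assumes g: "lip_bump L r g" and r: "r \<ge> 0" and int: "integrable lborel (fourier1 g)"
  shows "of_real (tensor g w) = (LINT y|lborel. tensor (fourier1 g) y * cis (2 * pi * (w \<bullet> y)))"
proof -
  let ?f = "\<lambda>i t. fourier1 g t * cis ((2 * pi * (w $ i)) * t)"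
  have "(LINT y|lborel. tensor (fourier1 g) y * cis (2 * pi * (w \<bullet> y))) =
        (LINT y|lborel. (\<Prod>i\<in>UNIV. ?f i ((y::real^'n) $ i)))"
    by (intro Bochner_Integration.integral_cong refl)
       (simp add: tensor_def prod.distrib inner_vec_def cis_sum[symmetric] sum_distrib_left mult_ac)
  also have "\<dots> = (\<Prod>i\<in>UNIV. LINT t|lborel. ?f i t)"
    by (rule integral_vec_prod) (rule fourier1_weighted_integrable[OF g int])
  also have "\<dots> = of_real (tensor g w)"
    using fourier1_inversion[OF g r int] by (simp add: tensor_def mult_ac)
  finally show ?thesis by simp
qed

lemma tensor_integrable:
  fixes G :: "real \<Rightarrow> complex"
  assumes "integrable lborel G"
  shows "integrable lborel (tensor G :: real^'n \<Rightarrow> complex)"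
  unfolding tensor_def[abs_def] by (rule integrable_vec_prod) (rule assms)

lemma tensor_borel [measurable (raw)]:
  fixes g :: "real \<Rightarrow> 'a::{second_countable_topology, real_normed_field}"
  assumes [measurable]: "g \<in> borel_measurable borel"
  shows "(tensor g :: real^'n \<Rightarrow> 'a) \<in> borel_measurable borel"
  unfolding tensor_def[abs_def] by measurable

text \<open>
  Insert the inversion formula for the kernel and exchange the integrals. The transform of
  \<open>f\<close> is bounded but possibly not integrable; that of the kernel provides the
  convergence.
\<close>

lemma convolution_formula:
  fixes f :: "real^'n \<Rightarrow> complex"
  assumes f: "integrable lborel f"
    and g: "lip_bump L r g" and r: "r \<ge> 0" and int: "integrable lborel (fourier1 g)"
  shows "(LINT z|lborel. f z * of_real (tensor g (x - z))) =
    (LINT y|lborel. tensor (fourier1 g) y * (LINT z|lborel. f z * cis (- (2 * pi * (z \<bullet> y)))) * cis (2 * pi * (x \<bullet> y)))"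
proof -
  note [measurable] = lip_bumpD(4)[OF g] fourier1_measurable[OF lip_bumpD(4)[OF g]]
  have [measurable]: "f \<in> borel_measurable borel" using f by auto
  have [measurable]: "(tensor (fourier1 g) :: real^'n \<Rightarrow> complex) \<in> borel_measurable borel" by measurable
  note G = tensor_integrable[OF int, where 'n = 'n]
  let ?h = "\<lambda>z y. f z * (tensor (fourier1 g) y * cis (2 * pi * ((x - z) \<bullet> y)))"
  have int2: "integrable (lborel \<Otimes>\<^sub>M lborel) (case_prod ?h)"
  proof (rule lborel_pair.Fubini_integrable)
    show "case_prod ?h \<in> borel_measurable (lborel \<Otimes>\<^sub>M lborel)" by measurable
    show "integrable lborel (\<lambda>z. LINT y|lborel. norm (case_prod ?h (z, y)))"
      using f by (simp add: norm_mult)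
    show "AE z in lborel. integrable lborel (\<lambda>y. case_prod ?h (z, y))"
    proof (rule AE_I2)
      fix z
      have "integrable lborel (\<lambda>y::real^'n. f z * tensor (fourier1 g) y)"
        by (rule integrable_mult_right) (rule G)
      then show "integrable lborel (\<lambda>y. case_prod ?h (z, y))"
        by (rule Bochner_Integration.integrable_bound) (auto simp: norm_mult)
    qed
  qed
  have "(LINT z|lborel. f z * of_real (tensor g (x - z))) = (LINT z|lborel. LINT y|lborel. ?h z y)"
    by (simp add: tensor_inversion[OF g r int])
  also have "\<dots> = (LINT y|lborel. LINT z|lborel. ?h z y)"
    using lborel_pair.Fubini_integral[OF int2] by simp
  also have "\<dots> = (LINT y|lborel. tensor (fourier1 g) y * (LINT z|lborel. f z * cis (- (2 * pi * (z \<bullet> y)))) * cis (2 * pi * (x \<bullet> y)))"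
  proof (intro Bochner_Integration.integral_cong refl)
    fix y :: "real^'n"
    have eq: "?h z y = f z * cis (- (2 * pi * (z \<bullet> y))) * (tensor (fourier1 g) y * cis (2 * pi * (x \<bullet> y)))" for z
    proof -
      have "cis (2 * pi * ((x - z) \<bullet> y)) = cis (- (2 * pi * (z \<bullet> y))) * cis (2 * pi * (x \<bullet> y))"
        by (simp add: cis_mult inner_diff_left algebra_simps)
      then show ?thesis by (simp add: mult_ac)
    qed
    show "(LINT z|lborel. ?h z y) = tensor (fourier1 g) y * (LINT z|lborel. f z * cis (- (2 * pi * (z \<bullet> y)))) * cis (2 * pi * (x \<bullet> y))"
      unfolding eq integral_mult_left_zero by (simp only: mult_ac)
  qed
  finally show ?thesis .
qed

section \<open>Quasi-analyticity along lines\<close>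

text \<open>
  Expand \<open>w * q ^ m * (l - q)\<^sup>2 \<ge> 0\<close>, integrate, and take for
  \<open>l\<close> the ratio of the first two moments involved.
\<close>

lemma moment_log_convex:
  fixes w q :: "'a \<Rightarrow> real"
  assumes int: "\<And>m. integrable \<mu> (\<lambda>y. w y * q y ^ m)"
    and w: "\<And>y. w y \<ge> 0" and q: "\<And>y. q y \<ge> 0"
    and pos: "\<And>m. (LINT y|\<mu>. w y * q y ^ m) > 0"
  shows "log_convex (\<lambda>m. LINT y|\<mu>. w y * q y ^ m)"
  unfolding log_convex_def
proof (intro conjI allI pos)
  fix m
  define M where "M m = (LINT y|\<mu>. w y * q y ^ m)" for m
  define l where "l = M (Suc m) / M m"
  have l: "l > 0" unfolding l_def M_def by (intro divide_pos_pos pos)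
  have "(LINT y|\<mu>. 2 * l * (w y * q y ^ Suc m)) \<le> (LINT y|\<mu>. l\<^sup>2 * (w y * q y ^ m) + w y * q y ^ Suc (Suc m))"
  proof (intro integral_mono integrable_mult_right Bochner_Integration.integrable_add int)
    fix y
    have "0 \<le> w y * q y ^ m * (l - q y)\<^sup>2"
      using w[of y] q[of y] by simp
    then show "2 * l * (w y * q y ^ Suc m) \<le> l\<^sup>2 * (w y * q y ^ m) + w y * q y ^ Suc (Suc m)"
      by (simp add: power2_diff power2_eq_square algebra_simps)
  qed
  then have "2 * l * M (Suc m) \<le> l\<^sup>2 * M m + M (Suc (Suc m))"
    using int by (simp add: M_def del: power_Suc)
  also have "l\<^sup>2 * M m = l * M (Suc m)"
    using pos[of m] by (simp add: l_def M_def power2_eq_square)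
  finally have "l * M (Suc m) \<le> M (Suc (Suc m))" by simp
  then have "M m * (l * M (Suc m)) \<le> M m * M (Suc (Suc m))"
    using pos[of m] by (intro mult_left_mono) (auto simp: M_def)
  moreover have "M m * (l * M (Suc m)) = M (Suc m) ^ 2"
    using pos[of m] by (simp add: l_def M_def power2_eq_square)
  ultimately show "(LINT y|\<mu>. w y * q y ^ Suc m)\<^sup>2 \<le> (LINT y|\<mu>. w y * q y ^ m) * (LINT y|\<mu>. w y * q y ^ Suc (Suc m))"
    by (simp only: M_def)
qed

lemma iexp_taylor:
  "norm (cis x - (\<Sum>i<n. (\<i> * of_real x) ^ i / fact i)) \<le> \<bar>x\<bar> ^ n / fact n"
proof (cases n)
  case (Suc m)
  then show ?thesis using iexp_approx1[of x m] by (simp add: cis_conv_exp lessThan_Suc_atMost)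
qed simp

text \<open>
  The \<open>j\<close>-th derivative of \<open>t \<mapsto> \<integral> W exp (i t u)\<close>,
  written as the integral that differentiation under the integral sign would produce.
\<close>

definition line_deriv :: "'a measure \<Rightarrow> ('a \<Rightarrow> complex) \<Rightarrow> ('a \<Rightarrow> real) \<Rightarrow> nat \<Rightarrow> real \<Rightarrow> complex" where
  "line_deriv \<mu> W u j t = (LINT y|\<mu>. W y * (\<i> * of_real (u y)) ^ j * cis (t * u y))"

text \<open>
  Taylor's inequality for the complex exponential, integrated against \<open>W * (i u) ^ j * exp (i
  t u)\<close>; the remainder produces the moment of order \<open>j + n\<close>.
\<close>

lemma line_deriv_taylor:
  assumes [measurable]: "W \<in> borel_measurable \<mu>" "u \<in> borel_measurable \<mu>"
    and int: "\<And>m. integrable \<mu> (\<lambda>y. norm (W y) * q y ^ m)" and uq: "\<And>y. \<bar>u y\<bar> \<le> q y"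
  shows "norm (line_deriv \<mu> W u j (t + s) - (\<Sum>i<n. line_deriv \<mu> W u (j + i) t * of_real (s ^ i / fact i)))
    \<le> (LINT y|\<mu>. norm (W y) * q y ^ (j + n)) * \<bar>s\<bar> ^ n / fact n"
proof -
  let ?I = "\<lambda>j t y. W y * (\<i> * of_real (u y)) ^ j * cis (t * u y)"
  have i: "integrable \<mu> (?I j t)" for j t
  proof (rule Bochner_Integration.integrable_bound[OF int[of j]])
    show "AE y in \<mu>. norm (?I j t y) \<le> norm (norm (W y) * q y ^ j)"
    proof (rule AE_I2)
      fix y
      have "\<bar>u y\<bar> ^ j \<le> \<bar>q y ^ j\<bar>"
        using power_mono[OF uq[of y], of j] by simp
      then show "norm (?I j t y) \<le> norm (norm (W y) * q y ^ j)"
        by (simp add: norm_mult norm_power abs_mult mult_left_mono)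
    qed
  qed measurable
  let ?R = "\<lambda>y. ?I j (t + s) y - (\<Sum>i<n. ?I (j + i) t y * of_real (s ^ i / fact i))"
  have iR: "integrable \<mu> ?R"
    by (intro Bochner_Integration.integrable_diff i Bochner_Integration.integrable_sum integrable_mult_left)
  have "(\<Sum>i<n. line_deriv \<mu> W u (j + i) t * of_real (s ^ i / fact i)) =
      (\<Sum>i<n. LINT y|\<mu>. ?I (j + i) t y * of_real (s ^ i / fact i))"
    unfolding line_deriv_def by (simp only: integral_mult_left_zero)
  also have "\<dots> = (LINT y|\<mu>. (\<Sum>i<n. ?I (j + i) t y * of_real (s ^ i / fact i)))"
    by (rule Bochner_Integration.integral_sum[symmetric]) (rule integrable_mult_left, rule i)
  finally have "line_deriv \<mu> W u j (t + s) - (\<Sum>i<n. line_deriv \<mu> W u (j + i) t * of_real (s ^ i / fact i)) =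
      (LINT y|\<mu>. ?I j (t + s) y) - (LINT y|\<mu>. (\<Sum>i<n. ?I (j + i) t y * of_real (s ^ i / fact i)))"
    by (simp only: line_deriv_def)
  also have "\<dots> = integral\<^sup>L \<mu> ?R"
    by (rule Bochner_Integration.integral_diff[symmetric])
       (rule i, rule Bochner_Integration.integrable_sum, rule integrable_mult_left, rule i)
  finally have "norm (line_deriv \<mu> W u j (t + s) - (\<Sum>i<n. line_deriv \<mu> W u (j + i) t * of_real (s ^ i / fact i)))
      = norm (integral\<^sup>L \<mu> ?R)" by (rule arg_cong)
  also have "\<dots> \<le> (LINT y|\<mu>. norm (?R y))" by (rule integral_norm_bound)
  also have "\<dots> \<le> (LINT y|\<mu>. \<bar>s\<bar> ^ n / fact n * (norm (W y) * q y ^ (j + n)))"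
  proof (rule integral_mono)
    show "integrable \<mu> (\<lambda>y. norm (?R y))" by (rule integrable_norm[OF iR])
    show "integrable \<mu> (\<lambda>y. \<bar>s\<bar> ^ n / fact n * (norm (W y) * q y ^ (j + n)))"
      by (rule integrable_mult_right) (rule int)
    fix y
    have "?R y = W y * (\<i> * of_real (u y)) ^ j * cis (t * u y) * (cis (s * u y) - (\<Sum>i<n. (\<i> * of_real (s * u y)) ^ i / fact i))"
    proof -
      have c: "cis ((t + s) * u y) = cis (t * u y) * cis (s * u y)" by (simp add: cis_mult algebra_simps)
      have p: "?I (j + i) t y * of_real (s ^ i / fact i) =
        W y * (\<i> * of_real (u y)) ^ j * cis (t * u y) * ((\<i> * of_real (s * u y)) ^ i / fact i)" for i
        by (simp add: power_add power_mult_distrib mult_ac)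
      show ?thesis
        unfolding c p right_diff_distrib sum_distrib_left by (simp only: mult.assoc)
    qed
    then have "norm (?R y) = norm (W y) * \<bar>u y\<bar> ^ j * norm (cis (s * u y) - (\<Sum>i<n. (\<i> * of_real (s * u y)) ^ i / fact i))"
      by (simp add: norm_mult norm_power)
    also have "\<dots> \<le> norm (W y) * \<bar>u y\<bar> ^ j * (\<bar>s * u y\<bar> ^ n / fact n)"
      by (intro mult_left_mono iexp_taylor) auto
    also have "\<dots> = \<bar>s\<bar> ^ n / fact n * (norm (W y) * \<bar>u y\<bar> ^ (j + n))"
      by (simp add: abs_mult power_mult_distrib power_add mult_ac)
    also have "\<dots> \<le> \<bar>s\<bar> ^ n / fact n * (norm (W y) * q y ^ (j + n))"
      using uq by (intro mult_left_mono power_mono) auto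
    finally show "norm (?R y) \<le> \<bar>s\<bar> ^ n / fact n * (norm (W y) * q y ^ (j + n))" .
  qed
  also have "\<dots> = (LINT y|\<mu>. norm (W y) * q y ^ (j + n)) * \<bar>s\<bar> ^ n / fact n"
    unfolding integral_mult_right_zero by simp
  finally show ?thesis .
qed

text \<open>
  Taylor's inequality of order two at a zero of the \<open>j\<close>-th function, compared with
  nearby zeros of it, forces the next function to vanish.
\<close>

lemma derivatives_vanish:
  fixes h :: "nat \<Rightarrow> real \<Rightarrow> complex"
  assumes taylor: "\<And>j n t s. norm (h j (t + s) - (\<Sum>i<n. h (j + i) t * of_real (s ^ i / fact i))) \<le> M (j + n) * \<bar>s\<bar> ^ n / fact n"
    and e: "e > 0" and zero: "\<And>t. \<bar>t\<bar> < e \<Longrightarrow> h 0 t = 0"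
  shows "\<bar>t\<bar> < e \<Longrightarrow> h j t = 0"
proof (induction j arbitrary: t)
  case (Suc j)
  have "((\<lambda>s. M (j + 2) * s / 2) \<longlongrightarrow> M (j + 2) * 0 / 2) (at_right 0)"
    by (intro tendsto_intros) simp
  moreover have "eventually (\<lambda>s. norm (h (Suc j) t) \<le> M (j + 2) * s / 2) (at_right 0)"
    unfolding eventually_at_right_field
  proof (intro exI[of _ "e - \<bar>t\<bar>"] conjI allI impI)
    fix s assume s: "0 < s" "s < e - \<bar>t\<bar>"
    have set2: "{..<2} = {0, 1::nat}" by auto
    have "h j (t + s) = 0" "h j t = 0" using s Suc.prems by (auto intro!: Suc.IH)
    then have "norm (h (Suc j) t) * s \<le> M (j + 2) * s\<^sup>2 / 2"
      using taylor[of j t s 2] s by (simp add: norm_mult set2)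
    then have "norm (h (Suc j) t) * s \<le> (M (j + 2) * s / 2) * s"
      by (simp add: power2_eq_square)
    then show "norm (h (Suc j) t) \<le> M (j + 2) * s / 2"
      using s by (auto intro: mult_right_le_imp_le)
  qed (use Suc.prems in auto)
  ultimately have "norm (h (Suc j) t) \<le> M (j + 2) * 0 / 2"
    by (rule tendsto_lowerbound) simp
  then show ?case by simp
qed (use zero in auto)

text \<open>
  The bound \<open>q \<ge> 1\<close> makes all moments positive as soon as the zeroth one is, so
  log-convexity is available unless \<open>W\<close> vanishes almost everywhere.
\<close>

lemma line_quasianalytic:
  assumes [measurable]: "W \<in> borel_measurable \<mu>" "u \<in> borel_measurable \<mu>"
    and int: "\<And>m. integrable \<mu> (\<lambda>y. norm (W y) * q y ^ m)" and uq: "\<And>y. \<bar>u y\<bar> \<le> q y"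
    and q1: "\<And>y. q y \<ge> 1"
    and div: "log_convex (\<lambda>m. LINT y|\<mu>. norm (W y) * q y ^ m) \<Longrightarrow>
      \<not> summable (\<lambda>m. (LINT y|\<mu>. norm (W y) * q y ^ m) / (LINT y|\<mu>. norm (W y) * q y ^ Suc m))"
    and e: "e > 0" and zero: "\<And>t. \<bar>t\<bar> < e \<Longrightarrow> (LINT y|\<mu>. W y * cis (t * u y)) = 0"
    and s: "0 \<le> s"
  shows "(LINT y|\<mu>. W y * cis (s * u y)) = 0"
proof (cases "(LINT y|\<mu>. norm (W y)) > 0")
  case False
  have W: "integrable \<mu> (\<lambda>y. norm (W y))" using int[of 0] by simp
  have "(LINT y|\<mu>. norm (W y)) \<ge> 0" by simp
  with False have "(LINT y|\<mu>. norm (W y)) = 0" by linarith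
  then have "AE y in \<mu>. W y = 0" using integral_nonneg_eq_0_iff_AE[OF W] by simp
  then have "AE y in \<mu>. W y * cis (s * u y) = 0" by eventually_elim simp
  then show ?thesis by (rule integral_eq_zero_AE)
next
  case True
  let ?M = "\<lambda>m. LINT y|\<mu>. norm (W y) * q y ^ m"
  have "?M m > 0" for m
  proof -
    have "(LINT y|\<mu>. norm (W y)) \<le> ?M m"
      using int[of 0] int[of m] q1 by (intro integral_mono) (auto simp: mult_le_cancel_left1)
    with True show ?thesis by linarith
  qed
  then have lc: "log_convex ?M"
    using q1 by (intro moment_log_convex int) (auto intro: order.trans[OF zero_le_one])
  note taylor = line_deriv_taylor[OF assms(1,2) int uq]
  have z: "line_deriv \<mu> W u 0 t = 0" if "\<bar>t\<bar> < e" for t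
    using zero[OF that] by (simp add: line_deriv_def)
  have d: "line_deriv \<mu> W u j 0 = 0" for j
    by (rule derivatives_vanish[where h = "line_deriv \<mu> W u" and M = ?M, OF taylor e z]) (use e in auto)
  have "line_deriv \<mu> W u 0 (0 + s) = 0"
    by (rule bang_quasianalytic[where h = "line_deriv \<mu> W u" and M = ?M, OF lc div[OF lc] taylor d s])
  then show ?thesis by (simp add: line_deriv_def)
qed

section \<open>Growth of the moments\<close>

lemma power_le_exp:
  fixes y :: real
  assumes "y \<ge> 0" "k \<ge> 1"
  shows "y ^ k \<le> real k ^ k * exp y"
proof -
  have "y / real k \<le> exp (y / real k)"
    using exp_ge_add_one_self[of "y / real k"] by linarith
  then have "(y / real k) ^ k \<le> exp (y / real k) ^ k"
    using assms by (intro power_mono) auto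
  also have "\<dots> = exp (real k * (y / real k))" by (rule exp_of_nat_mult[symmetric])
  also have "real k * (y / real k) = y" using assms by simp
  finally show ?thesis using assms by (simp add: power_divide pos_divide_le_eq mult_ac)
qed

text \<open>
  The weight on the left has the form \<open>exp (- \<chi> r * r)\<close> with a decreasing
  \<open>\<chi>\<close> for which \<open>\<chi> (2 ^ k)\<close> is summable, as is required for the
  construction of a kernel.
\<close>

lemma sqrt_weight_decay:
  assumes "r \<ge> 0"
  shows "exp (- (5 / sqrt (1 + r)) * r) \<le> exp 5 * exp (- (5 * sqrt (1 + r)))"
proof -
  define y where "y = sqrt (1 + r)"
  have y: "y \<ge> 1" "r = y * y - 1" using assms by (auto simp: y_def)
  have "5 / y \<le> 5" using y by (simp add: pos_divide_le_eq)
  then have "5 * y - 5 \<le> 5 * y - 5 / y" by linarith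
  also have "\<dots> = 5 / y * r" using y by (simp add: field_simps)
  finally show ?thesis unfolding exp_add[symmetric] y_def[symmetric] by simp
qed

text \<open>
  For \<open>r \<le> m ^ 4\<close> one may replace \<open>\<phi> r\<close> by \<open>l = \<phi> (m ^
  4)\<close>, and \<open>x ^ m * exp (- l * x) \<le> (m / l) ^ m\<close>. For \<open>r > m ^
  4\<close> and \<open>x = 1 + r = y ^ 4\<close> one has \<open>m < y\<close>, hence \<open>x ^ m =
  y ^ (4 * m) \<le> exp (4 * y\<^sup>2) = exp (4 * sqrt x)\<close>, which the square root weight
  absorbs; this is where its constant \<open>5 = 4 + 1\<close> comes from.
\<close>

lemma moment_weight_bound:
  fixes \<phi> :: "real \<Rightarrow> real"
  assumes anti: "antimono_on {0..} \<phi>" and pos: "\<And>r. r \<ge> 0 \<Longrightarrow> \<phi> r > 0"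
    and r: "r \<ge> 0" and m: "m \<ge> 1"
  shows "(1 + r) ^ m * exp (- \<phi> r * r) * exp (- (5 / sqrt (1 + r)) * r)
     \<le> exp (5 + \<phi> 0) * (max 1 (\<phi> 0) * real m / \<phi> (real m ^ 4)) ^ m * exp (- sqrt (1 + r))"
proof -
  define x where "x = 1 + r"
  define l where "l = \<phi> (real m ^ 4)"
  define B where "B = max 1 (\<phi> 0)"
  have x: "x \<ge> 1" using r by (simp add: x_def)
  have anti\<phi>: "\<phi> s \<le> \<phi> r" if "0 \<le> r" "r \<le> s" for r s
    using anti that by (auto simp: monotone_on_def)
  have l: "l > 0" "l \<le> \<phi> 0" unfolding l_def by (auto intro: pos anti\<phi>)
  have Bl: "1 \<le> B * real m / l"
  proof -
    have "l \<le> B" using l by (simp add: B_def)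
    also have "B * 1 \<le> B * real m" using m by (intro mult_left_mono) (auto simp: B_def)
    finally show ?thesis using l by simp
  qed
  have chi: "exp (- (5 / sqrt x) * r) \<le> exp 5 * exp (- (5 * sqrt x))"
    unfolding x_def by (rule sqrt_weight_decay[OF r])
  have main: "x ^ m * exp (- \<phi> r * r) * exp (- (5 * sqrt x)) \<le> exp (\<phi> 0) * (B * real m / l) ^ m * exp (- sqrt x)"
  proof (cases "r \<le> real m ^ 4")
    case True
    have "exp (- \<phi> r * r) \<le> exp (\<phi> 0 + - (l * x))"
    proof -
      have "l * r \<le> \<phi> r * r" unfolding l_def using r True by (intro mult_right_mono anti\<phi>) auto
      then show ?thesis using l by (simp add: x_def algebra_simps)
    qed
    moreover have "x ^ m \<le> (real m / l) ^ m * exp (l * x)"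
    proof -
      have "(l * x) ^ m \<le> real m ^ m * exp (l * x)"
        using l x m by (intro power_le_exp) auto
      then show ?thesis using l by (simp add: power_mult_distrib power_divide pos_le_divide_eq mult_ac)
    qed
    ultimately have "x ^ m * exp (- \<phi> r * r) \<le> ((real m / l) ^ m * exp (l * x)) * exp (\<phi> 0 + - (l * x))"
      using l by (intro mult_mono) auto
    also have "\<dots> = exp (\<phi> 0) * (real m / l) ^ m"
      unfolding exp_add by (simp add: exp_minus field_simps)
    also have "\<dots> \<le> exp (\<phi> 0) * (B * real m / l) ^ m"
      using l by (intro mult_left_mono power_mono divide_right_mono) (auto simp: B_def mult_le_cancel_right1)
    finally have "x ^ m * exp (- \<phi> r * r) \<le> exp (\<phi> 0) * (B * real m / l) ^ m" .
    moreover have "exp (- (5 * sqrt x)) \<le> exp (- sqrt x)" using x by simp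
    ultimately show ?thesis
      using Bl by (rule_tac mult_mono) auto
  next
    case False
    define y where "y = sqrt (sqrt x)"
    have y: "y \<ge> 1" "x = y ^ 4" "sqrt x = y ^ 2"
    proof -
      show "y \<ge> 1" and "sqrt x = y ^ 2" using x by (auto simp: y_def)
      have "x = (sqrt x)\<^sup>2" using x by simp
      also have "\<dots> = y ^ 4" unfolding \<open>sqrt x = y ^ 2\<close> by (simp flip: power_mult)
      finally show "x = y ^ 4" .
    qed
    have "real m ^ 4 < y ^ 4" using False y x_def by linarith
    then have my: "real m < y" using y by (rule_tac power_less_imp_less_base[of _ 4]) auto
    have ye: "y \<le> exp y" using exp_ge_add_one_self[of y] by linarith
    have "x ^ m = y ^ (4 * m)" by (simp add: y power_mult)
    also have "\<dots> \<le> exp y ^ (4 * m)"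
      using y ye by (intro power_mono) auto
    also have "\<dots> = exp (real (4 * m) * y)" by (rule exp_of_nat_mult[symmetric])
    also have "\<dots> \<le> exp (4 * sqrt x)"
      using my y by (simp add: power2_eq_square)
    finally have "x ^ m * exp (- \<phi> r * r) * exp (- (5 * sqrt x)) \<le> exp (4 * sqrt x) * 1 * exp (- (5 * sqrt x))"
      using pos[OF r] r by (intro mult_mono) auto
    also have "\<dots> = 1 * 1 * exp (- sqrt x)" by (simp add: exp_add[symmetric])
    also have "\<dots> \<le> exp (\<phi> 0) * (B * real m / l) ^ m * exp (- sqrt x)"
      using Bl pos[of 0] by (intro mult_mono one_le_power) auto
    finally show ?thesis .
  qed
  have "x ^ m * exp (- \<phi> r * r) * exp (- (5 / sqrt x) * r) \<le> x ^ m * exp (- \<phi> r * r) * (exp 5 * exp (- (5 * sqrt x)))"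
    using chi x by (intro mult_left_mono) auto
  also have "\<dots> = exp 5 * (x ^ m * exp (- \<phi> r * r) * exp (- (5 * sqrt x)))" by (simp only: mult_ac)
  also have "\<dots> \<le> exp 5 * (exp (\<phi> 0) * (B * real m / l) ^ m * exp (- sqrt x))"
    using main by (rule mult_left_mono) simp
  finally show ?thesis by (simp only: x_def l_def B_def exp_add mult_ac)
qed

lemma integrable_cauchy_density: "integrable lborel (\<lambda>t::real. 1 / (1 + t\<^sup>2))"
  using integrable_inverse_1_plus_square
  by (simp add: set_integrable_def einterval_def inverse_eq_divide)

lemma integrable_exp_sqrt_real: "integrable lborel (\<lambda>s::real. exp (- sqrt (1 + \<bar>s\<bar>)))"
proof (rule Bochner_Integration.integrable_bound)
  show "integrable lborel (\<lambda>t::real. 256 * (1 / (1 + t\<^sup>2)))"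
    by (intro integrable_mult_right integrable_cauchy_density)
  show "AE s in lborel. norm (exp (- sqrt (1 + \<bar>s\<bar>))) \<le> norm (256 * (1 / (1 + s\<^sup>2)))"
  proof (rule AE_I2)
    fix s :: real
    have "sqrt (1 + \<bar>s\<bar>) ^ 4 \<le> real 4 ^ 4 * exp (sqrt (1 + \<bar>s\<bar>))" by (rule power_le_exp) auto
    also have "sqrt (1 + \<bar>s\<bar>) ^ 4 = (1 + \<bar>s\<bar>)\<^sup>2"
      using power_mult[of "sqrt (1 + \<bar>s\<bar>)" 2 2] by simp
    finally have "1 + s\<^sup>2 \<le> 256 * exp (sqrt (1 + \<bar>s\<bar>))" by (simp add: power2_sum)
    then show "norm (exp (- sqrt (1 + \<bar>s\<bar>))) \<le> norm (256 * (1 / (1 + s\<^sup>2)))"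
      by (simp add: exp_minus divide_simps mult_ac add_pos_nonneg abs_of_pos)
  qed
qed measurable

text \<open>
  The function is dominated by a multiple of the product of the functions \<open>1 / (1 +
  t\<^sup>2)\<close> in the coordinates, because it decays faster than every power.
\<close>

lemma integrable_exp_sqrt: "integrable lborel (\<lambda>y::real^'n. exp (- sqrt (1 + norm y)))"
proof (rule Bochner_Integration.integrable_bound)
  let ?k = "4 * CARD('n)"
  let ?P = "\<lambda>y::real^'n. \<Prod>i\<in>UNIV. complex_of_real (1 / (1 + (y $ i)\<^sup>2))"
  have "integrable lborel ?P"
    by (rule integrable_vec_prod) (intro integrable_of_real integrable_cauchy_density)
  then show "integrable lborel (\<lambda>y. complex_of_real (real ?k ^ ?k) * ?P y)"
    by (rule integrable_mult_right)
  show "AE y in lborel. norm (exp (- sqrt (1 + norm y))) \<le> norm (complex_of_real (real ?k ^ ?k) * ?P y)"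
  proof (rule AE_I2)
    fix y :: "real^'n"
    define x where "x = 1 + norm y"
    have x: "x \<ge> 1" by (simp add: x_def)
    have "(\<Prod>i\<in>UNIV. 1 + (y $ i)\<^sup>2) \<le> (\<Prod>i\<in>(UNIV::'n set). x\<^sup>2)"
    proof (intro prod_mono conjI)
      fix i
      have "\<bar>y $ i\<bar>\<^sup>2 \<le> (norm y)\<^sup>2" by (intro power_mono component_le_norm_cart) auto
      moreover have "x\<^sup>2 = 1 + (norm y)\<^sup>2 + 2 * norm y" by (simp add: x_def power2_sum)
      ultimately show "1 + (y $ i)\<^sup>2 \<le> x\<^sup>2"
        using norm_ge_zero[of y] unfolding power2_abs by linarith
    qed (simp add: add_nonneg_nonneg)
    also have "\<dots> = sqrt x ^ ?k"
    proof -
      have "sqrt x ^ 4 = x\<^sup>2" using power_mult[of "sqrt x" 2 2] x by simp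
      then show ?thesis by (simp add: power_mult)
    qed
    also have "\<dots> \<le> real ?k ^ ?k * exp (sqrt x)"
      using x by (intro power_le_exp) (auto simp: Suc_le_eq)
    finally have *: "(\<Prod>i\<in>UNIV. 1 + (y $ i)\<^sup>2) \<le> real ?k ^ ?k * exp (sqrt x)" .
    have p: "(\<Prod>i\<in>UNIV. 1 + (y $ i)\<^sup>2) > 0" by (intro prod_pos) (simp add: add_pos_nonneg)
    have eq: "norm (complex_of_real (real ?k ^ ?k) * ?P y) = real ?k ^ ?k / (\<Prod>i\<in>UNIV. 1 + (y $ i)\<^sup>2)"
    proof -
      have "?P y = complex_of_real (1 / (\<Prod>i\<in>UNIV. 1 + (y $ i)\<^sup>2))"
        by (simp add: prod_dividef)
      then show ?thesis using p by (simp only: of_real_mult[symmetric] norm_of_real) simp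
    qed
    then show "norm (exp (- sqrt (1 + norm y))) \<le> norm (complex_of_real (real ?k ^ ?k) * ?P y)"
    proof -
      have "exp (- sqrt x) * (\<Prod>i\<in>UNIV. 1 + (y $ i)\<^sup>2) \<le> exp (- sqrt x) * (real ?k ^ ?k * exp (sqrt x))"
        using * by (rule mult_left_mono) simp
      also have "\<dots> = real ?k ^ ?k" by (simp add: exp_minus)
      finally have "exp (- sqrt x) \<le> real ?k ^ ?k / (\<Prod>i\<in>UNIV. 1 + (y $ i)\<^sup>2)"
        using p by (simp only: pos_le_divide_eq)
      then show ?thesis unfolding eq x_def by simp
    qed
  qed
qed measurable

section \<open>Convolutions vanish identically\<close>

lemma tensor_support:
  fixes w :: "real^'n"
  assumes g: "lip_bump L d g" and w: "norm w > real CARD('n) * d"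
  shows "tensor g w = 0"
proof -
  have "\<exists>i. \<bar>w $ i\<bar> > d"
  proof (rule ccontr)
    assume "\<not> ?thesis"
    then have "(\<Sum>i\<in>UNIV. \<bar>w $ i\<bar>) \<le> (\<Sum>i\<in>(UNIV::'n set). d)" by (intro sum_mono) (auto simp: not_less)
    with norm_le_l1_cart[of w] w show False by simp
  qed
  then obtain i where "g (w $ i) = 0" using lip_bumpD(3)[OF g] by blast
  then show ?thesis unfolding tensor_def by (intro prod_zero) auto
qed

text \<open>
  On the line from the centre \<open>x1\<close> of the ball through \<open>x\<close>, the
  convolution is an integral of \<open>W y * cis (t * u y)\<close> with \<open>u\<close> linear. It
  vanishes for small \<open>t\<close> since the support of the kernel is shorter than the radius,
  and the moments of \<open>W\<close> satisfy the growth condition, so that it also vanishes at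
  \<open>t = 1\<close>.
\<close>

lemma convolution_vanishes:
  fixes f :: "real^'n \<Rightarrow> complex" and \<phi> :: "real \<Rightarrow> real"
  assumes f: "integrable lborel f"
    and anti: "antimono_on {0..} \<phi>" and pos: "\<And>r. r \<ge> 0 \<Longrightarrow> \<phi> r > 0"
    and div: "\<not> summable (\<lambda>k. \<phi> (2 ^ k))"
    and F: "\<And>y. norm (LINT z|lborel. f z * cis (- (2 * pi * (z \<bullet> y)))) \<le> C * exp (- \<phi> (norm y) * norm y)"
    and C: "C \<ge> 0"
    and g: "lip_bump L d g" "d \<ge> 0" "(LINT t|lborel. g t) = 1"
    and gd: "\<And>s. norm (fourier1 g s) \<le> C' * exp (- (real CARD('n) * (5 / sqrt (1 + \<bar>s\<bar>))) * \<bar>s\<bar>)"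
    and C': "C' \<ge> 0"
    and zero: "AE z in lborel. z \<in> ball x1 \<rho> \<longrightarrow> f z = 0" and \<rho>: "real CARD('n) * d < \<rho>"
  shows "(LINT z|lborel. f z * of_real (tensor g (x - z))) = 0"
proof -
  note [measurable] = lip_bumpD(4)[OF g(1)]
  have [measurable]: "f \<in> borel_measurable borel" using f by auto
  have ftm [measurable]: "fourier1 g \<in> borel_measurable borel" by (rule fourier1_measurable) measurable
  have chi_anti: "antimono_on {0..} (\<lambda>r. 5 / sqrt (1 + r))"
    by (auto simp: monotone_on_def intro!: divide_left_mono mult_pos_pos)
  have int: "integrable lborel (fourier1 g)"
  proof (rule Bochner_Integration.integrable_bound)
    show "integrable lborel (\<lambda>s::real. C' * exp 5 * exp (- sqrt (1 + \<bar>s\<bar>)))"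
      by (rule integrable_mult_right) (rule integrable_exp_sqrt_real)
    show "AE s in lborel. norm (fourier1 g s) \<le> norm (C' * exp 5 * exp (- sqrt (1 + \<bar>s\<bar>)))"
    proof (rule AE_I2)
      fix s :: real
      have "norm (fourier1 g s) \<le> C' * exp (- (real CARD('n) * (5 / sqrt (1 + \<bar>s\<bar>))) * \<bar>s\<bar>)" by (rule gd)
      also have "\<dots> \<le> C' * exp (- (5 / sqrt (1 + \<bar>s\<bar>)) * \<bar>s\<bar>)"
      proof -
        have "1 * (5 / sqrt (1 + \<bar>s\<bar>) * \<bar>s\<bar>) \<le> real CARD('n) * (5 / sqrt (1 + \<bar>s\<bar>) * \<bar>s\<bar>)"
          by (intro mult_right_mono) (auto simp: Suc_le_eq)
        then show ?thesis using C' by (intro mult_left_mono) (auto simp: mult.assoc)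
      qed
      also have "\<dots> \<le> C' * (exp 5 * exp (- (5 * sqrt (1 + \<bar>s\<bar>))))"
        using C' by (intro mult_left_mono sqrt_weight_decay) auto
      also have "\<dots> \<le> C' * (exp 5 * exp (- sqrt (1 + \<bar>s\<bar>)))"
        using C' by (intro mult_left_mono) auto
      finally show "norm (fourier1 g s) \<le> norm (C' * exp 5 * exp (- sqrt (1 + \<bar>s\<bar>)))"
        using C' by (simp add: mult_ac)
    qed
  qed measurable
  define F where "F y = (LINT z|lborel. f z * cis (- (2 * pi * (z \<bullet> y))))" for y
  have [measurable]: "F \<in> borel_measurable borel" unfolding F_def[abs_def] by measurable
  define conv where "conv x = (LINT z|lborel. f z * of_real (tensor g (x - z)))" for x
  define v where "v = x - x1"
  define u where "u y = 2 * pi * (v \<bullet> y)" for y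
  define W where "W y = tensor (fourier1 g) y * F y * cis (2 * pi * (x1 \<bullet> y))" for y
  define K where "K = 1 + 2 * pi * norm v"
  \<comment> \<open>A majorant of \<open>\<bar>u\<bar>\<close> that is also bounded below by one.\<close>
  define q where "q y = K * (1 + norm y)" for y :: "real^'n"
  have K: "K \<ge> 1" by (simp add: K_def)
  have q1: "q y \<ge> 1" for y
    using mult_mono[of 1 K 1 "1 + norm y"] K by (simp add: q_def)
  have [measurable]: "u \<in> borel_measurable borel" unfolding u_def by measurable
  have [measurable]: "q \<in> borel_measurable borel" unfolding q_def by measurable
  have [measurable]: "(tensor (fourier1 g) :: real^'n \<Rightarrow> complex) \<in> borel_measurable borel" by measurable
  have [measurable]: "W \<in> borel_measurable borel" unfolding W_def by measurable
  have conv_eq: "conv (x1 + t *\<^sub>R v) = (LINT y|lborel. W y * cis (t * u y))" for t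
  proof -
    have "conv (x1 + t *\<^sub>R v) = (LINT y|lborel. tensor (fourier1 g) y * F y * cis (2 * pi * ((x1 + t *\<^sub>R v) \<bullet> y)))"
      unfolding conv_def F_def by (rule convolution_formula[OF f g(1,2) int])
    also have "\<dots> = (LINT y|lborel. W y * cis (t * u y))"
    proof (intro Bochner_Integration.integral_cong refl)
      fix y
      have "cis (2 * pi * ((x1 + t *\<^sub>R v) \<bullet> y)) = cis (2 * pi * (x1 \<bullet> y)) * cis (t * u y)"
        by (simp add: cis_mult u_def inner_add_left algebra_simps)
      then show "tensor (fourier1 g) y * F y * cis (2 * pi * ((x1 + t *\<^sub>R v) \<bullet> y)) = W y * cis (t * u y)"
        by (simp add: W_def)
    qed
    finally show ?thesis .
  qed
  have W_le: "norm (W y) \<le> C' * C * (exp (- \<phi> (norm y) * norm y) * exp (- (5 / sqrt (1 + norm y)) * norm y))" for y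
  proof -
    have "norm (tensor (fourier1 g) y) \<le> C' * exp (- (5 / sqrt (1 + norm y)) * norm y)"
      by (rule tensor_fourier1_decay[OF g(1,3) gd C' chi_anti]) auto
    then have "norm (tensor (fourier1 g) y) * norm (F y) \<le>
      (C' * exp (- (5 / sqrt (1 + norm y)) * norm y)) * (C * exp (- \<phi> (norm y) * norm y))"
      using F[of y] C' by (intro mult_mono) (auto simp: F_def)
    then show ?thesis by (simp add: W_def norm_mult mult_ac)
  qed
  define E where "E = C' * C * exp (5 + \<phi> 0)"
  define B where "B m = max 1 (\<phi> 0) * real m / \<phi> (real m ^ 4)" for m
  have E: "E \<ge> 0" using C C' by (simp add: E_def)
  have Wq: "norm (W y) * q y ^ m \<le> E * (K * B m) ^ m * exp (- sqrt (1 + norm y))" if m: "m \<ge> 1" for y m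
  proof -
    have "norm (W y) * q y ^ m \<le> C' * C * (exp (- \<phi> (norm y) * norm y) * exp (- (5 / sqrt (1 + norm y)) * norm y)) * q y ^ m"
      using q1[of y] by (intro mult_right_mono W_le) auto
    also have "\<dots> = C' * C * K ^ m * ((1 + norm y) ^ m * exp (- \<phi> (norm y) * norm y) * exp (- (5 / sqrt (1 + norm y)) * norm y))"
      by (simp only: q_def power_mult_distrib mult_ac)
    also have "\<dots> \<le> C' * C * K ^ m * (exp (5 + \<phi> 0) * B m ^ m * exp (- sqrt (1 + norm y)))"
      unfolding B_def using C C' K by (intro mult_left_mono moment_weight_bound[OF anti pos _ m]) auto
    finally show ?thesis by (simp only: E_def power_mult_distrib mult_ac)
  qed
  have intW1: "integrable lborel (\<lambda>y. norm (W y) * q y ^ m)" if m: "m \<ge> 1" for m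
  proof (rule Bochner_Integration.integrable_bound)
    show "integrable lborel (\<lambda>y::real^'n. E * (K * B m) ^ m * exp (- sqrt (1 + norm y)))"
      by (rule integrable_mult_right) (rule integrable_exp_sqrt)
    show "AE y in lborel. norm (norm (W y) * q y ^ m) \<le> norm (E * (K * B m) ^ m * exp (- sqrt (1 + norm y)))"
    proof (rule AE_I2)
      fix y
      have "0 \<le> norm (W y) * q y ^ m" using q1[of y] by simp
      with Wq[OF m, of y] show "norm (norm (W y) * q y ^ m) \<le> norm (E * (K * B m) ^ m * exp (- sqrt (1 + norm y)))"
        by simp
    qed
  qed measurable
  have intW: "integrable lborel (\<lambda>y. norm (W y) * q y ^ m)" for m
  proof (cases "m \<ge> 1")
    case False
    show ?thesis
    proof (rule Bochner_Integration.integrable_bound[OF intW1[of 1]])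
      show "AE y in lborel. norm (norm (W y) * q y ^ m) \<le> norm (norm (W y) * q y ^ 1)"
      proof (rule AE_I2)
        fix y
        have "norm (W y) * 1 \<le> norm (W y) * q y" by (intro mult_left_mono q1) auto
        moreover from this have "\<bar>norm (W y) * q y\<bar> = norm (W y) * q y"
          by (intro abs_of_nonneg) (rule order.trans[of _ "norm (W y)"], auto)
        moreover have "m = 0" using False by simp
        ultimately show "norm (norm (W y) * q y ^ m) \<le> norm (norm (W y) * q y ^ 1)" by simp
      qed
    qed auto
  qed (rule intW1)
  define A where "A = E * (LINT y|(lborel :: (real^'n) measure). exp (- sqrt (1 + norm y))) + 1"
  have A: "A > 0" unfolding A_def using E by (intro add_nonneg_pos mult_nonneg_nonneg integral_nonneg_AE) auto
  have growth: "(LINT y|lborel. norm (W y) * q y ^ m) \<le> A * ((K * max 1 (\<phi> 0)) * real m / \<phi> (real m ^ 4)) ^ m" if m: "m \<ge> 1" for m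
  proof -
    have B: "B m \<ge> 0" using pos[of "real m ^ 4"] by (auto simp: B_def intro!: divide_nonneg_nonneg mult_nonneg_nonneg)
    have "(LINT y|lborel. norm (W y) * q y ^ m) \<le> (LINT y|(lborel :: (real^'n) measure). E * (K * B m) ^ m * exp (- sqrt (1 + norm y)))"
      by (intro integral_mono intW integrable_mult_right integrable_exp_sqrt Wq m)
    also have "\<dots> = E * (LINT y|(lborel :: (real^'n) measure). exp (- sqrt (1 + norm y))) * (K * B m) ^ m"
      by simp
    also have "\<dots> \<le> A * (K * B m) ^ m"
      using K B by (intro mult_right_mono) (auto simp: A_def)
    finally show ?thesis by (simp add: B_def mult_ac)
  qed
  have e: "(\<rho> - real CARD('n) * d) / (1 + norm v) > 0" (is "?e > 0")
    using \<rho> by (intro divide_pos_pos add_pos_nonneg) auto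
  have "(LINT y|lborel. W y * cis (1 * u y)) = 0"
  proof (rule line_quasianalytic[where q = q and e = ?e])
    show "\<bar>u y\<bar> \<le> q y" for y
    proof -
      have "\<bar>u y\<bar> \<le> 2 * pi * (norm v * norm y)"
        unfolding u_def abs_mult using Cauchy_Schwarz_ineq2[of v y] by (simp add: mult_left_mono)
      also have "\<dots> \<le> K * (1 + norm y)" by (simp add: K_def algebra_simps)
      finally show ?thesis by (simp add: q_def)
    qed
    show "\<not> summable (\<lambda>m. (LINT y|lborel. norm (W y) * q y ^ m) / (LINT y|lborel. norm (W y) * q y ^ Suc m))"
      if "log_convex (\<lambda>m. LINT y|lborel. norm (W y) * q y ^ m)"
      by (rule divergent_of_growth[OF that anti pos div A _ growth]) (use K in \<open>auto intro!: mult_pos_pos\<close>)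
    show "(LINT y|lborel. W y * cis (t * u y)) = 0" if t: "\<bar>t\<bar> < ?e" for t
    proof -
      have "conv (x1 + t *\<^sub>R v) = 0"
        unfolding conv_def
      proof (rule integral_eq_zero_AE)
        show "AE z in lborel. f z * of_real (tensor g (x1 + t *\<^sub>R v - z)) = 0"
          using zero
        proof eventually_elim
          case (elim z)
          show ?case
          proof (cases "z \<in> ball x1 \<rho>")
            case False
            have "\<bar>t\<bar> * norm v \<le> \<bar>t\<bar> * (1 + norm v)" by (intro mult_left_mono) auto
            also have "\<dots> < \<rho> - real CARD('n) * d"
              using t by (simp add: pos_less_divide_eq add_pos_nonneg)
            finally have "norm (t *\<^sub>R v) < \<rho> - real CARD('n) * d" by simp
            moreover have "norm (x1 - z) \<ge> \<rho>" using False by (simp add: dist_norm)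
            moreover have "norm (x1 - z) \<le> norm (x1 + t *\<^sub>R v - z) + norm (t *\<^sub>R v)"
              using norm_triangle_ineq4[of "x1 + t *\<^sub>R v - z" "t *\<^sub>R v"] by simp
            ultimately have "tensor g (x1 + t *\<^sub>R v - z) = 0"
              by (intro tensor_support[OF g(1)]) linarith
            then show ?thesis by simp
          qed (use elim in auto)
        qed
      qed
      then show ?thesis by (simp add: conv_eq)
    qed
  qed (use intW q1 e in auto)
  then have "conv (x1 + 1 *\<^sub>R v) = 0" by (simp only: conv_eq)
  then show ?thesis by (simp add: v_def conv_def)
qed

section \<open>Shrinking kernels and integrals over boxes\<close>

lemma tensor_integral:
  assumes g: "lip_bump L d g"
  shows "integrable lborel (tensor g :: real^'n \<Rightarrow> real)"
    and "(LINT x|lborel. tensor g (x::real^'n)) = (LINT t|lborel. g t) ^ CARD('n)"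
proof -
  have i: "integrable lborel (\<lambda>t. complex_of_real (g t))"
    using lip_bump_integrable[OF g] by simp
  have eq: "(\<Prod>i\<in>UNIV. complex_of_real (g (x $ i))) = complex_of_real (tensor g x)" for x :: "real^'n"
    by (simp add: tensor_def)
  have "integrable lborel (\<lambda>x::real^'n. complex_of_real (tensor g x))"
    using integrable_vec_prod[where 'n = 'n, of "\<lambda>_ t. complex_of_real (g t)", OF i] unfolding eq .
  then have "integrable lborel (\<lambda>x::real^'n. Re (complex_of_real (tensor g x)))"
    by (rule integrable_Re)
  then show "integrable lborel (tensor g :: real^'n \<Rightarrow> real)" by simp
  have "complex_of_real (LINT x|lborel. tensor g (x::real^'n)) = complex_of_real ((LINT t|lborel. g t) ^ CARD('n))"
    using integral_vec_prod[where 'n = 'n, of "\<lambda>_ t. complex_of_real (g t)", OF i]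
    unfolding eq by (simp add: integral_complex_of_real)
  then show "(LINT x|lborel. tensor g (x::real^'n)) = (LINT t|lborel. g t) ^ CARD('n)"
    by (simp only: of_real_eq_iff)
qed

lemma
  fixes h :: "real^'n \<Rightarrow> real"
  assumes h: "integrable lborel h"
  shows integrable_translate: "integrable lborel (\<lambda>x. h (x - z))"
    and integral_translate: "(LINT x|lborel. h (x - z)) = (LINT x|lborel. h x)"
proof -
  have hm: "h \<in> borel_measurable borel" using h by auto
  have T: "(+) (- z) \<in> measurable lborel borel" by simp
  have "integrable (distr lborel borel ((+) (- z))) h"
    using h by (simp add: lborel_distr_plus)
  then show "integrable lborel (\<lambda>x. h (x - z))"
    by (subst (asm) integrable_distr_eq[OF T hm]) simp
  have "(LINT x|lborel. h x) = (LINT x|distr lborel borel ((+) (- z)). h x)"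
    by (simp add: lborel_distr_plus)
  also have "\<dots> = (LINT x|lborel. h (x - z))"
    by (subst integral_distr[OF T hm]) simp
  finally show "(LINT x|lborel. h (x - z)) = (LINT x|lborel. h x)" by simp
qed

lemma tensor_nonneg: "lip_bump L d g \<Longrightarrow> tensor g x \<ge> 0"
  unfolding tensor_def by (intro prod_nonneg) (auto dest: lip_bumpD(2))

text \<open>
  Integrate the convolutions over the box and exchange the integrals: \<open>f\<close> is integrated
  against the function \<open>h k\<close>, the indicator function of the box smeared out by the
  kernel. Away from the boundary of the box, which is a null set, \<open>h k\<close> equals the
  indicator function as soon as the kernel is narrow enough.
\<close>

lemma box_integral_eq_0:
  fixes f :: "real^'n \<Rightarrow> complex"
  assumes f: "integrable lborel f" and d0: "d0 > 0"
    and ker: "\<And>d. 0 < d \<Longrightarrow> d < d0 \<Longrightarrow> \<exists>L g. lip_bump L d g \<and> (LINT t|lborel. g t) = 1 \<and>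
      (\<forall>x. (LINT z|lborel. f z * of_real (tensor g (x - z))) = 0)"
  shows "(LINT z|lborel. indicator (box a b) z *\<^sub>R f z) = 0"
proof -
  have [measurable]: "f \<in> borel_measurable borel" using f by auto
  \<comment> \<open>Half of \<open>d0\<close>, so that already the first width is admissible.\<close>
  define d where "d k = d0 / 2 * inverse (real (Suc k))" for k
  have d: "0 < d k" "d k < d0" for k
  proof -
    show "0 < d k" using d0 by (simp add: d_def)
    have "d k \<le> d0 / 2 * 1" unfolding d_def using d0 by (intro mult_left_mono) (auto simp: inverse_le_1_iff)
    then show "d k < d0" using d0 by simp
  qed
  have "(\<lambda>k. d0 / 2 * inverse (real (Suc k))) \<longlonglongrightarrow> d0 / 2 * 0"
    by (intro tendsto_intros LIMSEQ_inverse_real_of_nat)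
  then have dlim: "d \<longlonglongrightarrow> 0" by (simp add: d_def[abs_def])
  from ker[OF d] obtain L g where g: "\<And>k. lip_bump (L k) (d k) (g k)" "\<And>k. (LINT t|lborel. g k t) = 1"
    and conv: "\<And>k x. (LINT z|lborel. f z * of_real (tensor (g k) (x - z))) = 0"
    by metis
  note [measurable] = lip_bumpD(4)[OF g(1)]
  have [measurable]: "(tensor (g k) :: real^'n \<Rightarrow> real) \<in> borel_measurable borel" for k by measurable
  note ti = tensor_integral[OF g(1), where 'n = 'n]
  have t1: "(LINT x|lborel. tensor (g k) (x - z)) = 1" for k and z :: "real^'n"
    using integral_translate[OF ti(1)] ti(2) g(2) by simp
  note tint = integrable_translate[OF ti(1)]
  define h where "h k z = (LINT x|lborel. indicator (box a b) x * tensor (g k) (x - z))" for k z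
  have hm [measurable]: "h k \<in> borel_measurable borel" for k unfolding h_def[abs_def] by measurable
  have hint: "integrable lborel (\<lambda>x. indicator (box a b) x * tensor (g k) (x - z))" for k z
    by (rule Bochner_Integration.integrable_bound[OF tint[of k z]])
       (use tensor_nonneg[OF g(1)] in \<open>auto split: split_indicator\<close>)
  have h0: "0 \<le> h k z" for k z
    unfolding h_def using tensor_nonneg[OF g(1)] by (intro integral_nonneg_AE AE_I2 mult_nonneg_nonneg) auto
  have h1: "h k z \<le> 1" for k z
  proof -
    have "h k z \<le> (LINT x|lborel. tensor (g k) (x - z))"
      unfolding h_def using tensor_nonneg[OF g(1)]
      by (intro integral_mono hint tint) (auto split: split_indicator)
    then show ?thesis using t1 by simp
  qed
  have fh: "(LINT z|lborel. f z * of_real (h k z)) = 0" for k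
  proof -
    let ?F = "\<lambda>z x. f z * of_real (indicator (box a b) x * tensor (g k) (x - z))"
    have int2: "integrable (lborel \<Otimes>\<^sub>M lborel) (case_prod ?F)"
    proof (rule lborel_pair.Fubini_integrable)
      show "case_prod ?F \<in> borel_measurable (lborel \<Otimes>\<^sub>M lborel)" by measurable
      have "(LINT x|lborel. norm (case_prod ?F (z, x))) = norm (f z) * h k z" for z
        by (simp add: norm_mult h_def tensor_nonneg[OF g(1)])
      moreover have "integrable lborel (\<lambda>z. norm (f z) * h k z)"
        by (rule Bochner_Integration.integrable_bound[OF f])
           (use h0 h1 in \<open>auto simp: abs_mult mult_left_le\<close>)
      ultimately show "integrable lborel (\<lambda>z. LINT x|lborel. norm (case_prod ?F (z, x)))" by simp
      show "AE z in lborel. integrable lborel (\<lambda>x. case_prod ?F (z, x))"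
      proof (rule AE_I2)
        fix z
        have "integrable lborel (\<lambda>x. complex_of_real (indicator (box a b) x * tensor (g k) (x - z)))"
          using hint by (rule integrable_of_real)
        then show "integrable lborel (\<lambda>x. case_prod ?F (z, x))"
          unfolding prod.case by (rule integrable_mult_right)
      qed
    qed
    have "(LINT z|lborel. f z * of_real (h k z)) = (LINT z|lborel. LINT x|lborel. ?F z x)"
      unfolding h_def integral_mult_right_zero integral_complex_of_real ..
    also have "\<dots> = (LINT x|lborel. LINT z|lborel. ?F z x)"
      using lborel_pair.Fubini_integral[OF int2] by simp
    also have "\<dots> = (LINT x|(lborel :: (real^'n) measure). 0)"
    proof (intro Bochner_Integration.integral_cong refl)
      fix x
      have "(LINT z|lborel. ?F z x) = (LINT z|lborel. of_real (indicator (box a b) x) * (f z * of_real (tensor (g k) (x - z))))"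
        by (intro Bochner_Integration.integral_cong refl) (simp add: mult_ac)
      also have "\<dots> = 0" unfolding integral_mult_right_zero conv by simp
      finally show "(LINT z|lborel. ?F z x) = 0" .
    qed
    finally show ?thesis by simp
  qed
  have small: "eventually (\<lambda>k. \<forall>x. tensor (g k) (x - z) \<noteq> 0 \<longrightarrow> x \<in> S) sequentially"
    if S: "open S" "z \<in> S" for S and z :: "real^'n"
  proof -
    obtain e where e: "e > 0" "ball z e \<subseteq> S" using openE[OF S] by blast
    have "eventually (\<lambda>k. d k < e / real CARD('n)) sequentially"
      using dlim e by (intro order_tendstoD) auto
    then show ?thesis
    proof eventually_elim
      case (elim k)
      show ?case
      proof (intro allI impI)
        fix x assume "tensor (g k) (x - z) \<noteq> 0"
        then have "norm (x - z) \<le> real CARD('n) * d k"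
          using tensor_support[OF g(1)] by (meson not_le)
        also have "\<dots> < e" using elim by (simp add: pos_less_divide_eq mult_ac)
        finally show "x \<in> S" using e(2) by (auto simp: dist_norm norm_minus_commute)
      qed
    qed
  qed
  have hlim: "(\<lambda>k. h k z) \<longlonglongrightarrow> indicator (box a b) z" if z: "z \<notin> cbox a b - box a b" for z
  proof (cases "z \<in> box a b")
    case True
    from small[OF open_box True] have "eventually (\<lambda>k. h k z = 1) sequentially"
    proof eventually_elim
      case (elim k)
      have "h k z = (LINT x|lborel. tensor (g k) (x - z))"
        unfolding h_def by (intro Bochner_Integration.integral_cong refl) (use elim in \<open>auto split: split_indicator\<close>)
      then show ?case using t1 by simp
    qed
    then show ?thesis using True by (auto intro: tendsto_eventually)
  next
    case False
    with z have "z \<in> - cbox a b" by auto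
    from small[OF _ this] have "eventually (\<lambda>k. \<forall>x. tensor (g k) (x - z) \<noteq> 0 \<longrightarrow> x \<in> - cbox a b) sequentially"
      by (simp add: closed_cbox open_Compl)
    then have "eventually (\<lambda>k. h k z = 0) sequentially"
    proof eventually_elim
      case (elim k)
      have "h k z = (LINT x|(lborel :: (real^'n) measure). 0)"
        unfolding h_def
        by (intro Bochner_Integration.integral_cong refl)
           (use elim box_subset_cbox[of a b] in \<open>auto split: split_indicator\<close>)
      then show ?case by simp
    qed
    then show ?thesis using False by (auto intro: tendsto_eventually)
  qed
  have "(\<lambda>k. LINT z|lborel. f z * of_real (h k z)) \<longlonglongrightarrow> (LINT z|lborel. f z * of_real (indicator (box a b) z))"
  proof (rule integral_dominated_convergence[where w = "\<lambda>z. norm (f z)"])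
    have "AE z in lborel. z \<notin> cbox a b - box a b"
      by (rule AE_not_in) (rule null_sets_cbox_Diff_box)
    then show "AE z in lborel. (\<lambda>k. f z * of_real (h k z)) \<longlonglongrightarrow> f z * of_real (indicator (box a b) z)"
      by eventually_elim (intro tendsto_intros hlim)
    show "AE z in lborel. norm (f z * of_real (h k z)) \<le> norm (f z)" for k
      using h0 h1 by (auto simp: norm_mult mult_left_le)
  qed (use f in auto)
  then have "(LINT z|lborel. f z * of_real (indicator (box a b) z)) = 0"
    unfolding fh by (simp add: LIMSEQ_const_iff)
  moreover have "(\<lambda>z. f z * of_real (indicator (box a b) z)) = (\<lambda>z. indicator (box a b) z *\<^sub>R f z)"
    by (auto simp: scaleR_conv_of_real)
  ultimately show ?thesis by simp
qed

text \<open>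
  Boxes generate the Borel sets and are stable under intersection, so by Dynkin's argument the
  integral of \<open>f\<close> over every Borel set is zero.
\<close>

lemma AE_zero_of_box_integrals:
  fixes f :: "real^'n \<Rightarrow> complex"
  assumes f: "integrable lborel f"
    and box: "\<And>a b. (LINT z|lborel. indicator (box a b) z *\<^sub>R f z) = 0"
  shows "AE x in lborel. f x = 0"
proof (rule sigma_finite_measure.density_unique_banach[OF sigma_finite_lborel, of f "\<lambda>_. 0"])
  have [measurable]: "f \<in> borel_measurable borel" using f by auto
  let ?G = "range (\<lambda>(a, b). box a b) :: (real^'n) set set"
  have si: "integrable lborel (\<lambda>z. indicator A z *\<^sub>R f z)" if "A \<in> sets borel" for A
    using f that by (intro integrable_mult_indicator) auto
  have all: "(LINT z|lborel. f z) = 0"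
  proof -
    let ?B = "\<lambda>n::nat. box (- (real n *\<^sub>R One)) (real n *\<^sub>R One) :: (real^'n) set"
    have "(\<lambda>n. LINT z|lborel. indicator (?B n) z *\<^sub>R f z) \<longlonglongrightarrow> (LINT z|lborel. f z)"
    proof (rule integral_dominated_convergence[where w = "\<lambda>z. norm (f z)"])
      show "AE z in lborel. (\<lambda>n. indicator (?B n) z *\<^sub>R f z) \<longlonglongrightarrow> f z"
      proof (rule AE_I2)
        fix z :: "real^'n"
        have "z \<in> (\<Union>n. ?B n)" unfolding UN_box_eq_UNIV by simp
        then obtain n where n: "z \<in> ?B n" by auto
        have "eventually (\<lambda>m. indicator (?B m) z *\<^sub>R f z = f z) sequentially"
          unfolding eventually_sequentially
        proof (intro exI allI impI)
          fix m assume "n \<le> m"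
          then have "?B n \<subseteq> ?B m" by (auto simp: box_def)
          then show "indicator (?B m) z *\<^sub>R f z = f z" using n by auto
        qed
        then show "(\<lambda>n. indicator (?B n) z *\<^sub>R f z) \<longlonglongrightarrow> f z" by (rule tendsto_eventually)
      qed
      show "AE z in lborel. norm (indicator (?B n) z *\<^sub>R f z) \<le> norm (f z)" for n
        by (auto split: split_indicator)
    qed (use f in auto)
    then show ?thesis unfolding box by (simp add: LIMSEQ_const_iff)
  qed
  show "set_lebesgue_integral lborel A f = set_lebesgue_integral lborel A (\<lambda>_. 0)" if "A \<in> sets lborel" for A
  proof -
    have int_stable: "Int_stable ?G"
      by (auto simp: Int_stable_def box_Int_box)
    have subset_Pow_UNIV: "?G \<subseteq> Pow UNIV" by simp
    have A: "A \<in> sigma_sets UNIV ?G" using that by (simp add: borel_eq_box)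
    have "(LINT z|lborel. indicator A z *\<^sub>R f z) = 0"
      using int_stable subset_Pow_UNIV A
    proof (induction A rule: sigma_sets_induct_disjoint)
      case (compl A)
      then have "A \<in> sets borel" by (simp add: borel_eq_box)
      have "(LINT z|lborel. indicator (UNIV - A) z *\<^sub>R f z) = (LINT z|lborel. f z - indicator A z *\<^sub>R f z)"
        by (intro Bochner_Integration.integral_cong refl) (auto split: split_indicator)
      then show ?case using f si[OF \<open>A \<in> sets borel\<close>] compl.IH all by simp
    next
      case (union A)
      then have Am: "A i \<in> sets borel" for i by (auto simp: borel_eq_box)
      have "(LINT z:(\<Union>i. A i)|lborel. f z) = (\<Sum>i. (LINT z:(A i)|lborel. f z))"
      proof (rule lebesgue_integral_countable_add)
        show "set_integrable lborel (\<Union>i. A i) f"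
          unfolding set_integrable_def by (rule si) (use Am in auto)
        show "A i \<inter> A j = {}" if "i \<noteq> j" for i j
          using union.hyps(1) that by (auto simp: disjoint_family_on_def)
      qed (use Am in auto)
      then show ?case using union.IH by (simp add: set_lebesgue_integral_def)
    qed (auto simp: box)
    then show ?thesis by (simp add: set_lebesgue_integral_def)
  qed
qed (use f in auto)

section \<open>Ingham's theorem\<close>

lemma ingham_uniqueness:
  fixes f :: "real^'n \<Rightarrow> complex" and \<phi> :: "real \<Rightarrow> real"
  assumes f: "integrable lborel f"
    and anti: "antimono_on {0..} \<phi>" and nonneg: "\<And>r. r \<ge> 0 \<Longrightarrow> \<phi> r \<ge> 0"
    and div: "\<not> summable (\<lambda>k. \<phi> (2 ^ k))"
    and F: "\<And>y. norm (LINT z|lborel. f z * cis (- (2 * pi * (z \<bullet> y)))) \<le> C * exp (- \<phi> (norm y) * norm y)"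
    and zero: "AE z in lborel. z \<in> ball x1 \<rho> \<longrightarrow> f z = 0" and \<rho>: "\<rho> > 0"
  shows "AE x in lborel. f x = 0"
proof (rule AE_zero_of_box_integrals[OF f], rule box_integral_eq_0[OF f])
  have anti\<phi>: "\<phi> s \<le> \<phi> r" if "0 \<le> r" "r \<le> s" for r s
    using anti that by (auto simp: monotone_on_def)
  \<comment> \<open>A zero of \<open>\<phi>\<close> would persist from there on and make the series converge.\<close>
  have pos: "\<phi> r > 0" if r: "r \<ge> 0" for r
  proof (rule ccontr)
    assume "\<not> \<phi> r > 0"
    obtain k where k: "r < 2 ^ k" using real_arch_pow[of 2 r] by auto
    have "\<phi> (2 ^ j) = 0" if "j \<ge> k" for j
    proof -
      have "(2::real) ^ k \<le> 2 ^ j" using that by (intro power_increasing) auto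
      then have "\<phi> (2 ^ j) \<le> \<phi> r" using k r by (intro anti\<phi>) linarith+
      then show ?thesis using \<open>\<not> \<phi> r > 0\<close> nonneg[of "2 ^ j"] by simp
    qed
    then have "summable (\<lambda>k. \<phi> (2 ^ k))"
      by (intro summable_finite[of "{..<k}"]) (auto simp: not_less)
    with div show False by simp
  qed
  have C: "C \<ge> 0"
    using order.trans[OF norm_ge_zero F[of 0]] by simp
  let ?n = "real CARD('n)"
  show "0 < \<rho> / ?n" using \<rho> by simp
  fix d :: real assume d: "0 < d" "d < \<rho> / ?n"
  \<comment> \<open>The factor \<open>?n\<close> is lost in the passage from the line to the product kernel.\<close>
  let ?chi = "\<lambda>r. ?n * (5 / sqrt (1 + r))"
  have 1: "antimono_on {0..} ?chi"
    by (auto simp: monotone_on_def intro!: mult_left_mono divide_left_mono mult_pos_pos)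
  have 2: "?chi r \<ge> 0" if "r \<ge> 0" for r using that by simp
  have 3: "summable (\<lambda>k. ?chi (2 ^ k))"
  proof (intro summable_mult, rule summable_comparison_test')
    show "summable (\<lambda>k. 5 * (1 / sqrt 2) ^ k)"
      by (intro summable_mult summable_geometric) auto
    fix k :: nat
    have "sqrt (2 ^ k) \<le> sqrt (1 + 2 ^ k)" by simp
    then have "5 / sqrt (1 + 2 ^ k) \<le> 5 / sqrt (2 ^ k)" by (intro divide_left_mono mult_pos_pos) (auto intro: add_pos_pos)
    also have "\<dots> = 5 * (1 / sqrt 2) ^ k" by (simp add: real_sqrt_power power_one_over)
    finally show "norm (5 / sqrt (1 + 2 ^ k)) \<le> 5 * (1 / sqrt 2) ^ k" by simp
  qed
  from fast_decaying_kernel[OF 1 2 3 d(1)] obtain L g C' where g: "lip_bump L d g" "(LINT t|lborel. g t) = 1" "C' \<ge> 1"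
    "\<And>s. norm (fourier1 g s) \<le> C' * exp (- ?chi \<bar>s\<bar> * \<bar>s\<bar>)" by blast
  have "(LINT z|lborel. f z * of_real (tensor g (x - z))) = 0" for x
    by (rule convolution_vanishes[OF f anti pos div F C g(1) _ g(2) g(4) _ zero])
       (use d g(3) in \<open>auto simp: pos_less_divide_eq mult_ac\<close>)
  then show "\<exists>L g. lip_bump L d g \<and> (LINT t|lborel. g t) = 1 \<and>
      (\<forall>x. (LINT z|lborel. f z * of_real (tensor g (x - z))) = 0)"
    using g by blast
qed

text \<open>
  Fubini's theorem is applied to Borel functions, so \<open>f\<close> is first modified on a null
  set; neither its Fourier transform nor the conclusion is affected.
\<close>

lemma integrable_lebesgue_borel_version:
  fixes f :: "real^'n \<Rightarrow> complex"
  assumes f: "integrable lebesgue f"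
  shows "\<exists>g. integrable lborel g \<and> (AE x in lborel. f x = g x)"
proof -
  have "(\<lambda>x. Re (f x)) \<in> borel_measurable lebesgue" "(\<lambda>x. Im (f x)) \<in> borel_measurable lebesgue"
    using f by (auto dest: integrable_Re integrable_Im)
  from this[THEN completion_ex_borel_measurable_real] obtain u v where
    [measurable]: "u \<in> borel_measurable lborel" "v \<in> borel_measurable lborel"
    and ae: "AE x in lborel. Re (f x) = u x" "AE x in lborel. Im (f x) = v x"
    by blast
  define g where "g x = of_real (u x) + \<i> * of_real (v x)" for x
  have g [measurable]: "g \<in> borel_measurable lborel" unfolding g_def[abs_def] by measurable
  have eq: "AE x in lborel. f x = g x"
    using ae by eventually_elim (simp add: g_def complex_eq_iff)
  have "integrable lebesgue g"
    by (rule integrable_cong_AE_imp[OF f])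
       (use eq in \<open>auto intro!: AE_completion measurable_completion simp: eq_commute\<close>)
  then have "integrable lborel g" by (simp add: integrable_completion[OF g])
  with eq show ?thesis by blast
qed

theorem theorem2p2:
  fixes \<theta> :: "real ^ 'n \<Rightarrow> real"
  assumes "\<And>y. 0 \<le> \<theta> y"
    and "decreasing_radial \<theta>"
    and "(\<theta> \<longlongrightarrow> 0) at_infinity"
  shows "(\<forall>f :: real ^ 'n \<Rightarrow> complex. \<forall>U.
            integrable lebesgue f \<and> fourier_decay \<theta> f \<and>
            open U \<and> U \<noteq> {} \<and> (AE x in lebesgue. x \<in> U \<longrightarrow> f x = 0) \<and>
            tail_integral \<theta> = \<infinity>
            \<longrightarrow> (AE x in lebesgue. f x = 0)) \<and>
         (tail_integral \<theta> < \<infinity>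
            \<longrightarrow> (\<exists>f \<in> Cc_infinity. f \<noteq> (\<lambda>x. 0) \<and> fourier_decay \<theta> f))"
proof -
  obtain \<phi> :: "real \<Rightarrow> real" where anti: "antimono_on {0..} \<phi>" and \<theta>: "\<theta> = (\<lambda>y. \<phi> (norm y))"
    using assms(2) unfolding decreasing_radial_def by auto
  have nonneg: "\<phi> r \<ge> 0" if "r \<ge> 0" for r
  proof -
    obtain y :: "real^'n" where "norm y = r" using vector_choose_size[OF \<open>r \<ge> 0\<close>] by blast
    then show ?thesis using assms(1)[of y] \<theta> by simp
  qed
  note tail = tail_integral_finite_iff[OF anti nonneg, where 'n = 'n, folded \<theta>]
  show ?thesis
  proof (intro conjI allI impI)
    fix f :: "real^'n \<Rightarrow> complex" and U
    assume A: "integrable lebesgue f \<and> fourier_decay \<theta> f \<and> open U \<and> U \<noteq> {} \<and>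
      (AE x in lebesgue. x \<in> U \<longrightarrow> f x = 0) \<and> tail_integral \<theta> = \<infinity>"
    then obtain g where g: "integrable lborel g" and fg: "AE x in lborel. f x = g x"
      using integrable_lebesgue_borel_version by blast
    have g_meas [measurable]: "g \<in> borel_measurable borel" using g by auto
    from A obtain C where C: "\<And>y. norm (fourier_transform f y) \<le> C * exp (- \<theta> y * norm y)"
      unfolding fourier_decay_def by blast
    have ft: "fourier_transform f y = (LINT z|lborel. g z * cis (- (2 * pi * (z \<bullet> y))))" for y
    proof -
      have [measurable]: "f \<in> borel_measurable lebesgue" using A by auto
      have [measurable]: "(\<lambda>x. cis (- (2 * pi * (x \<bullet> y)))) \<in> borel_measurable lborel"
        using inner_borel[of y] by measurable
      have "fourier_transform f y = (LINT z|lebesgue. g z * cis (- (2 * pi * (z \<bullet> y))))"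
        unfolding fourier_transform_cis
      proof (rule integral_cong_AE)
        show "AE x in lebesgue. f x * cis (- (2 * pi * (x \<bullet> y))) = g x * cis (- (2 * pi * (x \<bullet> y)))"
          by (rule AE_completion) (use fg in eventually_elim, simp)
        have c: "(\<lambda>x. cis (- (2 * pi * (x \<bullet> y)))) \<in> borel_measurable lebesgue"
          by (rule measurable_completion) measurable
        show "(\<lambda>x. f x * cis (- (2 * pi * (x \<bullet> y)))) \<in> borel_measurable lebesgue"
          by (rule borel_measurable_times[OF _ c]) measurable
        show "(\<lambda>x. g x * cis (- (2 * pi * (x \<bullet> y)))) \<in> borel_measurable lebesgue"
          by (rule borel_measurable_times[OF _ c]) (rule measurable_completion, measurable)
      qed
      also have "\<dots> = (LINT z|lborel. g z * cis (- (2 * pi * (z \<bullet> y))))"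
        by (rule integral_completion) measurable
      finally show ?thesis .
    qed
    from A obtain x1 \<rho> where \<rho>: "\<rho> > 0" "ball x1 \<rho> \<subseteq> U"
      by (meson openE ex_in_conv)
    have "AE x in lborel. x \<in> U \<longrightarrow> f x = 0"
      using A by (simp add: AE_completion_iff)
    with fg have zero: "AE z in lborel. z \<in> ball x1 \<rho> \<longrightarrow> g z = 0"
      by eventually_elim (use \<rho> in auto)
    have div: "\<not> summable (\<lambda>k. \<phi> (2 ^ k))"
      using tail A by simp
    have "AE x in lborel. g x = 0"
      by (rule ingham_uniqueness[OF g anti nonneg div _ zero \<rho>(1)]) (use C in \<open>simp_all add: ft \<theta>\<close>)
    with fg have "AE x in lborel. f x = 0" by eventually_elim simp
    then show "AE x in lebesgue. f x = 0" by (rule AE_completion)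
  next
    assume "tail_integral \<theta> < \<infinity>"
    then have "summable (\<lambda>k. \<phi> (2 ^ k))" using tail by simp
    from ingham_construction[OF anti nonneg this]
    show "\<exists>f \<in> Cc_infinity. f \<noteq> (\<lambda>x. 0) \<and> fourier_decay \<theta> f"
      unfolding \<theta> by blast
  qed
qed

end
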